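(* For $\xi\in\{0,1\}^\omega$ let $I_\xi=\{\eta\in\{0,1\}^\omega : \Gamma_\xi \text{ and } \Gamma_\eta \text{ are isomorphic as unrooted graphs}\}$, where $\Gamma_\xi$ denotes the Schreier graph of the action of the Basilica group on the orbit of $\xi$. Then for every $\xi\in\{0,1\}^\omega$, $\lambda(I_\xi)=0$, where $\lambda$ is the uniform measure on $\{0,1\}^\omega$.
   Context: The Basilica group $B=\langle a,b\rangle$ acts on finite and infinite binary words by $a(0w)=0\,b(w)$, $a(1w)=1w$, $b(0w)=1\,a(w)$, $b(1w)=0w$. For $\xi\in\{0,1\}^\omega$, the Schreier graph $\Gamma_\xi$ is the undirected (unlabeled) multigraph with vertex set $B\cdot\xi$ and, for every vertex $x$ and $s\in\{a,b\}$, one edge joining $x$ and $s(x)$ (a loop if $s(x)=x$; parallel edges allowed). The uniform measure $\lambda$ is the product (Bernoulli $(1/2,1/2)$) Borel probability measure on $\{0,1\}^\omega$, giving each cylinder $w\{0,1\}^\omega$ measure $2^{-|w|}$. *)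

theory Defs
  imports
    "HOL-Probability.Probability"
    "HOL-Library.Uprod"
    "HOL-Algebra.Bij"
    "HOL-Algebra.Generated_Groups"
    "HOL-Algebra.Group_Action"
begin

section \<open>Infinite binary words\<close>

text \<open>The letter 0 is \<^const>\<open>False\<close> and the letter 1 is \<^const>\<open>True\<close>.\<close>

type_synonym word = "bool stream"

definition uniform_word_measure :: "word measure" where
  "uniform_word_measure = stream_space (measure_pmf (bernoulli_pmf (1/2)))"


section \<open>The Basilica group and its action\<close>

datatype gen = Gen_a | Gen_b

text \<open>The defining recursion in its usual form is \<open>act_simps\<close> below.\<close>

primcorec act :: "gen \<Rightarrow> word \<Rightarrow> word" where
  "act s x =
     (if s = Gen_a
      then if shd x then True ## stl x else False ## act Gen_b (stl x)
      else if shd x then False ## stl x else True ## act Gen_a (stl x))"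

text \<open>
  The group acts faithfully on infinite words (an element acting trivially on all infinite words
  acts trivially on all finite ones), so it is realised as a group of permutations of words.
\<close>

definition basilica :: "(word \<Rightarrow> word) monoid" where
  "basilica = (BijGroup UNIV)\<lparr>carrier := generate (BijGroup UNIV) (range act)\<rparr>"

definition basilica_orbit :: "word \<Rightarrow> word set" where
  "basilica_orbit \<xi> = orbit basilica (\<lambda>g. g) \<xi>"


section \<open>Undirected multigraphs\<close>

text \<open>A loop at \<open>v\<close> is an edge with ends \<^term>\<open>Upair v v\<close>.\<close>

record ('v, 'e) multigraph =
  verts :: "'v set"
  edges :: "'e set"
  ends :: "'e \<Rightarrow> 'v uprod"

definition multigraph_iso ::
  "('v, 'e) multigraph \<Rightarrow> ('w, 'f) multigraph \<Rightarrow> bool" where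
  "multigraph_iso G H \<longleftrightarrow>
     (\<exists>\<phi> \<psi>. bij_betw \<phi> (verts G) (verts H) \<and> bij_betw \<psi> (edges G) (edges H) \<and>
            (\<forall>e\<in>edges G. ends H (\<psi> e) = map_uprod \<phi> (ends G e)))"

definition schreier_graph :: "word \<Rightarrow> (word, word \<times> gen) multigraph" where
  "schreier_graph \<xi> =
     \<lparr>verts = basilica_orbit \<xi>,
      edges = basilica_orbit \<xi> \<times> UNIV,
      ends = (\<lambda>(x, s). Upair x (act s x))\<rparr>"

definition iso_class :: "word \<Rightarrow> word set" where
  "iso_class \<xi> = {\<eta>. multigraph_iso (schreier_graph \<xi>) (schreier_graph \<eta>)}"


section \<open>Consistency of the definitions\<close>

lemma act_simps [simp]:
  "act Gen_a (False ## w) = False ## act Gen_b w"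
  "act Gen_a (True ## w) = True ## w"
  "act Gen_b (False ## w) = True ## act Gen_a w"
  "act Gen_b (True ## w) = False ## w"
  by (subst act.code; simp)+

primcorec act_inv :: "gen \<Rightarrow> word \<Rightarrow> word" where
  "act_inv s x =
     (if s = Gen_a
      then if shd x then True ## stl x else False ## act_inv Gen_b (stl x)
      else if shd x then False ## act_inv Gen_a (stl x) else True ## stl x)"

lemma act_inv_act: "act_inv s (act s x) = x"
proof -
  have "(\<exists>s. y = act_inv s (act s z)) \<or> y = z \<Longrightarrow> y = z" for y z
  proof (coinduction arbitrary: y z)
    case Eq_stream
    then show ?case by (auto split: if_splits)
  qed
  then show ?thesis by blast
qed

lemma act_act_inv: "act s (act_inv s x) = x"
proof -
  have "(\<exists>s. y = act s (act_inv s z)) \<or> y = z \<Longrightarrow> y = z" for y z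
  proof (coinduction arbitrary: y z)
    case Eq_stream
    then show ?case by (auto split: if_splits)
  qed
  then show ?thesis by blast
qed

lemma bij_act: "bij (act s)"
  by (rule o_bij[of "act_inv s"]) (simp_all add: fun_eq_iff act_inv_act act_act_inv)

lemma act_in_Bij: "range act \<subseteq> carrier (BijGroup UNIV)"
  using bij_act by (auto simp: BijGroup_def Bij_def)

lemma group_basilica: "group basilica"
  unfolding basilica_def
  by (rule group.subgroup_imp_group[OF group_BijGroup
        group.generate_is_subgroup[OF group_BijGroup act_in_Bij]])

lemma group_action_basilica: "group_action basilica UNIV (\<lambda>g. g)"
proof -
  have "carrier basilica \<subseteq> carrier (BijGroup UNIV)"
    unfolding basilica_def
    by (simp add: group.generate_incl[OF group_BijGroup act_in_Bij])
  then have "(\<lambda>g. g) \<in> hom basilica (BijGroup UNIV)"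
    by (auto simp: hom_def basilica_def)
  then show ?thesis
    by (simp add: group_action_def group_hom_def group_hom_axioms_def group_basilica group_BijGroup)
qed

lemma emeasure_cylinder:
  "emeasure uniform_word_measure {x. stake (length w) x = w} = ennreal ((1/2) ^ length w)"
proof (induction w)
  case Nil
  interpret prob_space uniform_word_measure
    unfolding uniform_word_measure_def by (rule prob_space.prob_space_stream_space[OF measure_pmf.prob_space_axioms])
  have "space uniform_word_measure = UNIV"
    by (simp add: uniform_word_measure_def space_stream_space)
  then show ?case using emeasure_space_1 by simp
next
  case (Cons c w)
  have m: "{x. stake n x = u} \<in> sets uniform_word_measure" for n u
  proof -
    have *: "stake n \<in> measurable uniform_word_measure (count_space UNIV)"
      using measurable_stake[of n, where 'a = bool]
      unfolding uniform_word_measure_def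
      by (simp cong: measurable_cong_sets sets_stream_space_cong)
    show ?thesis
      using measurable_sets[OF *, of "{u}"]
      by (simp add: vimage_def uniform_word_measure_def space_stream_space)
  qed
  let ?M = "measure_pmf (bernoulli_pmf (1/2))"
  have "emeasure uniform_word_measure {x. stake (length (c # w)) x = c # w} =
     (\<integral>\<^sup>+t. emeasure uniform_word_measure {x. t = c \<and> stake (length w) x = w} \<partial>?M)"
    using prob_space.emeasure_stream_space[OF measure_pmf.prob_space_axioms m[of "length (c # w)" "c # w", unfolded uniform_word_measure_def]]
    by (simp add: uniform_word_measure_def space_stream_space)
  also have "\<dots> = (\<integral>\<^sup>+t. ennreal ((1/2) ^ length w) * indicator {c} t \<partial>?M)"
    by (intro nn_integral_cong) (auto simp: Cons.IH split: split_indicator)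
  also have "\<dots> = ennreal ((1/2) ^ length w) * emeasure ?M {c}"
    by (simp add: nn_integral_cmult_indicator)
  also have "emeasure ?M {c} = ennreal (1/2)"
    by (cases c) (simp_all add: emeasure_pmf_single)
  also have "ennreal ((1/2) ^ length w) * ennreal (1/2) = ennreal ((1/2) ^ length (c # w))"
    by (subst ennreal_mult[symmetric]) simp_all
  finally show ?case .
qed

end

theory Submission
  imports Defs
begin

text \<open>
  Write a word \<open>x\<close> as a sequence of letters \<open>x !! 0\<close>, \<open>x !! 1\<close>, ... and let \<open>n\<close> be the first even index
  that carries a 1. Then \<open>a\<close> decrements, modulo a power of 2, the binary number formed by the letters
  at the odd indices below \<open>n\<close>; the generator \<open>b\<close> does the same with the two parities exchanged
  (\<open>counter_act\<close>). So every vertex lies on one cycle for each generator, and the length of the cycle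
  is \<open>2 ^ (Suc n div 2)\<close>.

  Call a word generic if it has infinitely many 1s at even and at odd indices; almost all words are.
  At a generic vertex \<open>x\<close> let \<open>lead x\<close> be the first index of a 1 and \<open>turn x\<close> the first index of a 1 of
  the other parity. Erasing all letters below \<open>turn x\<close>, that is, setting them to 0, gives the parent of \<open>x\<close>. Adjacent
  vertices are equal, siblings, or parent and child (\<open>adjacent_parent\<close>), and a vertex together with its
  children forms a single cycle (\<open>children_iff\<close>). The Schreier graph of a generic word is thus a
  tree of cycles whose branches are finite and whose ancestor paths all run to the same end.

  This structure is visible to the graph without its labels. The descendants of a vertex \<open>p\<close>
  are exactly the vertices of the finite pieces that are attached to the rest of the graph at \<open>p\<close> only
  (\<open>descendants_iff_bud\<close>). Consequently an isomorphism commutes with the parent map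
  (\<open>adjacency_iso_parent\<close>) and preserves the number of children, which determines \<open>lead p\<close> up to two
  possibilities of different parity (\<open>adjacency_iso_lead\<close>). Now \<open>\<eta>\<close> has the letter 1 at the index
  \<open>lead p\<close> for every ancestor \<open>p\<close> of \<open>\<eta>\<close>. If the graphs of \<open>\<xi>\<close> and \<open>\<eta>\<close> are isomorphic, this
  forces \<open>\<eta>\<close> to have the letter 1 at all indices of one of countably many infinite sets that depend on
  \<open>\<xi>\<close> only (\<open>isomorphic_common_letters\<close>), and each of these events has probability 0.

  Measurability of the isomorphism class is a separate matter, since the existence of an
  isomorphism is an existential statement over an uncountable set. The graphs are locally finite,
  so an isomorphism that maps a given vertex to \<open>\<eta>\<close> can be recorded by a function with finitely
  many possible values at each argument, subject to constraints on finitely many arguments each. By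
  compactness its existence is equivalent to the solvability of all finite subsystems of
  constraints (\<open>pred_compact_choice\<close>), and each of these is a Borel condition on \<open>\<eta>\<close>.
\<close>


section \<open>The generators as odometers\<close>

lemma word_eqI:
  fixes x y :: "'a stream"
  assumes "\<And>i. x !! i = y !! i"
  shows "x = y"
proof -
  from assms have "\<forall>i. x !! i = y !! i" by simp
  then show ?thesis
  proof (coinduction arbitrary: x y)
    case Eq_stream
    then show ?case
      using spec[OF Eq_stream, of 0] spec[OF Eq_stream, of "Suc i" for i] by simp
  qed
qed

lemma all_nat_Suc: "(\<forall>i. P i) \<longleftrightarrow> P 0 \<and> (\<forall>i. P (Suc i))"
  by (metis nat.exhaust)

text \<open>
  The 1 at index \<open>n\<close> stops the recursion of \<open>s\<close>: \<open>a\<close> looks for it at the even indices, \<open>b\<close> at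
  the odd ones.
\<close>

definition pivot :: "gen \<Rightarrow> nat \<Rightarrow> word \<Rightarrow> bool" where
  "pivot s n x \<longleftrightarrow> (even n \<longleftrightarrow> s = Gen_a) \<and> x !! n \<and> (\<forall>i<n. even i = even n \<longrightarrow> \<not> x !! i)"

text \<open>
  If \<open>pivot s n x\<close>, then the class of \<open>x\<close> is the \<open>s\<close>-cycle through \<open>x\<close>, see \<open>same_cycle_act\<close>
  and \<open>counter_onto\<close>.
\<close>

definition same_cycle :: "nat \<Rightarrow> word \<Rightarrow> word \<Rightarrow> bool" where
  "same_cycle n x y \<longleftrightarrow> (\<forall>i. n \<le> i \<or> even i = even n \<longrightarrow> x !! i = y !! i)"

text \<open>
  The binary number, least significant digit first, written in the letters whose index is below
  \<open>n\<close> and of the parity opposite to \<open>n\<close>.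
\<close>

fun counter :: "nat \<Rightarrow> word \<Rightarrow> nat" where
  "counter 0 x = 0"
| "counter (Suc n) x = (if even n then of_bool (shd x) + 2 * counter n (stl x) else counter n (stl x))"

lemma pivot_0: "pivot s 0 x \<longleftrightarrow> s = Gen_a \<and> shd x"
  by (simp add: pivot_def)

lemma pivot_Suc:
  "pivot s (Suc n) x \<longleftrightarrow>
     (if s = Gen_a then \<not> shd x \<and> pivot Gen_b n (stl x) else pivot Gen_a n (stl x))"
  by (cases s) (auto simp: pivot_def All_less_Suc2)

lemma same_cycle_0: "same_cycle 0 x y \<longleftrightarrow> x = y"
  by (auto simp: same_cycle_def intro: word_eqI)

lemma same_cycle_Suc:
  "same_cycle (Suc n) x y \<longleftrightarrow> (even n \<or> shd x = shd y) \<and> same_cycle n (stl x) (stl y)"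
  unfolding same_cycle_def by (subst all_nat_Suc) auto

lemma same_cycle_refl: "same_cycle n x x"
  by (simp add: same_cycle_def)

lemma same_cycle_sym: "same_cycle n x y \<Longrightarrow> same_cycle n y x"
  by (simp add: same_cycle_def)

lemma same_cycle_trans: "same_cycle n x y \<Longrightarrow> same_cycle n y z \<Longrightarrow> same_cycle n x z"
  by (simp add: same_cycle_def)

lemma pivot_same_cycle: "same_cycle n x y \<Longrightarrow> pivot s n x \<longleftrightarrow> pivot s n y"
  by (auto simp: pivot_def same_cycle_def)

lemma pivot_act_iff: "pivot s n (act s x) \<longleftrightarrow> pivot s n x"
  by (induction n arbitrary: s x) (auto simp: pivot_0 pivot_Suc split: if_splits)

lemma same_cycle_act: "pivot s n x \<Longrightarrow> same_cycle n x (act s x)"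
proof (induction n arbitrary: s x)
  case 0
  then show ?case
    by (cases x) (auto simp: pivot_0 same_cycle_0)
next
  case (Suc n)
  from Suc.prems have "even n \<longleftrightarrow> s = Gen_b"
    by (cases s) (auto simp: pivot_def)
  with Suc show ?case
    by (cases s) (auto simp: pivot_Suc same_cycle_Suc same_cycle_refl split: if_splits)
qed

lemma counter_less: "counter n x < 2 ^ (Suc n div 2)"
proof (induction n arbitrary: x)
  case (Suc n)
  from Suc.IH[of "stl x"] show ?case by (cases "even n") auto
qed simp

text \<open>
  The generators are odometers run backwards. This is immediate from the recursion:
  \<open>a(0w) = 0 b(w)\<close> only shifts indices, while \<open>b(1w) = 0w\<close> and \<open>b(0w) = 1 a(w)\<close> are the decrement of
  the least significant digit without and with a borrow.
\<close>

lemma counter_act: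
  assumes "pivot s n x"
  shows "counter n (act s x) = (if counter n x = 0 then 2 ^ (Suc n div 2) - 1 else counter n x - 1)"
  using assms
proof (induction n arbitrary: s x)
  case 0
  then show ?case by simp
next
  case (Suc n)
  from Suc.prems have p: "even n \<longleftrightarrow> s = Gen_b"
    by (cases s) (auto simp: pivot_def)
  show ?case
  proof (cases s)
    case Gen_a
    with Suc p show ?thesis by (auto simp: pivot_Suc)
  next
    case Gen_b
    define K where "K = Suc n div 2"
    have "Suc (Suc n) div 2 = Suc K" using p Gen_b by (auto simp: K_def)
    moreover have "2 ^ Suc K - 1 = Suc (2 * (2 ^ K - 1 :: nat))"
      using one_le_power[of "2::nat" K] unfolding power_Suc by linarith
    moreover have "counter n (act Gen_a (stl x)) = (if counter n (stl x) = 0 then 2 ^ K - 1 else counter n (stl x) - 1)"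
      using Suc Gen_b by (simp add: pivot_Suc K_def)
    ultimately show ?thesis using p Gen_b
      by (cases "counter n (stl x)") (simp_all del: power_Suc add: pivot_Suc)
  qed
qed

lemma counter_inj: "same_cycle n x y \<Longrightarrow> counter n x = counter n y \<Longrightarrow> x = y"
proof (induction n arbitrary: x y)
  case 0
  then show ?case by (simp add: same_cycle_0)
next
  case (Suc n)
  have "shd x = shd y \<and> counter n (stl x) = counter n (stl y)"
  proof (cases "even n")
    case True
    with Suc.prems have "of_bool (shd x) + 2 * counter n (stl x) = of_bool (shd y) + 2 * counter n (stl y)"
      by simp
    then show ?thesis by (cases "shd x"; cases "shd y") (simp_all; presburger)+
  next
    case False
    with Suc.prems show ?thesis by (simp add: same_cycle_Suc)
  qed
  moreover have "same_cycle n (stl x) (stl y)" using Suc.prems by (simp add: same_cycle_Suc)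
  ultimately show ?case using Suc.IH by (auto intro: stream.expand)
qed

lemma counter_eq_0: "(\<forall>i<n. \<not> x !! i) \<Longrightarrow> counter n x = 0"
  by (induction n arbitrary: x) (auto simp: All_less_Suc2)

text \<open>
  Decrementing leads to 0, one further step wraps around to the largest value, and decrementing
  from there meets every value.
\<close>

lemma counter_onto:
  assumes "pivot s n x" "v < 2 ^ (Suc n div 2)"
  obtains y where "same_cycle n x y" "counter n y = v"
proof -
  have down: "\<exists>y. same_cycle n x y \<and> counter n y = v" if "same_cycle n x z" "v \<le> counter n z" for v z
    using that
  proof (induction "counter n z - v" arbitrary: z)
    case 0
    then show ?case by auto
  next
    case (Suc k)
    have "pivot s n z" using assms Suc.prems pivot_same_cycle by blast
    then have "same_cycle n x (act s z)" "counter n (act s z) = counter n z - 1"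
      using Suc same_cycle_act same_cycle_trans counter_act by fastforce+
    with Suc show ?case by force
  qed
  obtain z where z: "same_cycle n x z" "counter n z = 0"
    using down[of x 0] same_cycle_refl by auto
  then have "same_cycle n x (act s z)" "counter n (act s z) = 2 ^ (Suc n div 2) - 1"
    using assms same_cycle_act same_cycle_trans counter_act pivot_same_cycle by metis+
  then show ?thesis using down[of "act s z" v] assms(2) that by fastforce
qed

lemma card_same_cycle:
  assumes "pivot s n x"
  shows "card {y. same_cycle n x y} = 2 ^ (Suc n div 2)"
proof -
  have "bij_betw (counter n) {y. same_cycle n x y} {..<2 ^ (Suc n div 2)}"
    unfolding bij_betw_def
  proof
    show "inj_on (counter n) {y. same_cycle n x y}"
      by (intro inj_onI counter_inj) (simp_all add: same_cycle_def)
    have "\<exists>y. same_cycle n x y \<and> v = counter n y" if "v < 2 ^ (Suc n div 2)" for v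
      using counter_onto[OF assms that] by metis
    then show "counter n ` {y. same_cycle n x y} = {..<2 ^ (Suc n div 2)}"
      using counter_less by (auto simp: image_iff)
  qed
  from bij_betw_same_card[OF this] show ?thesis by simp
qed


section \<open>Orbits by group words\<close>

type_synonym gword = "(gen \<times> bool) list"

fun apply_letter :: "gen \<times> bool \<Rightarrow> word \<Rightarrow> word" where
  "apply_letter (s, fwd) x = (if fwd then act s x else act_inv s x)"

text \<open>
  Group words over the generators and their inverses name the vertices of a Schreier graph by a
  countable set that does not depend on the graph.
\<close>

definition run :: "gword \<Rightarrow> word \<Rightarrow> word" where
  "run w x = foldr apply_letter w x"

lemma run_Nil [simp]: "run [] x = x"
  and run_Cons [simp]: "run (l # w) x = apply_letter l (run w x)"
  and run_append: "run (u @ w) x = run u (run w x)"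
  by (simp_all add: run_def)

definition invert :: "gword \<Rightarrow> gword" where
  "invert w = rev (map (apsnd Not) w)"

lemma run_invert: "run (invert w) (run w x) = x"
  by (induction w) (auto simp: invert_def run_append act_inv_act act_act_inv)

lemma inv_act: "inv\<^bsub>BijGroup UNIV\<^esub> (act s) = act_inv s"
proof -
  have "act s \<in> Bij UNIV" using bij_act[of s] by (simp add: Bij_def)
  moreover have "inv_into UNIV (act s) = act_inv s"
    by (rule inv_equality) (simp_all add: act_inv_act act_act_inv)
  ultimately show ?thesis by (simp add: inv_BijGroup restrict_def)
qed

lemma mult_BijGroup_UNIV:
  "f \<in> Bij UNIV \<Longrightarrow> g \<in> Bij UNIV \<Longrightarrow> f \<otimes>\<^bsub>BijGroup UNIV\<^esub> g = f \<circ> g"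
  by (simp add: BijGroup_def compose_def fun_eq_iff restrict_def)

lemma one_BijGroup_UNIV: "\<one>\<^bsub>BijGroup UNIV\<^esub> = id"
  by (simp add: BijGroup_def fun_eq_iff restrict_def)

lemma basilica_carrier: "carrier basilica = range run"
proof
  let ?G = "generate (BijGroup UNIV) (range act)"
  have Bij: "g \<in> Bij UNIV" if "g \<in> ?G" for g
    using that group.generate_incl[OF group_BijGroup act_in_Bij] by (auto simp: BijGroup_def)
  have mult: "f \<circ> g \<in> ?G" if "f \<in> ?G" "g \<in> ?G" for f g
    using generate.eng[OF that] mult_BijGroup_UNIV[OF that[THEN Bij]] by simp
  have "\<exists>w. g = run w" if "g \<in> ?G" for g
    using that
  proof (induction rule: generate.induct)
    case one
    have "id = run []" by (simp add: fun_eq_iff)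
    then show ?case unfolding one_BijGroup_UNIV ..
  next
    case (incl h)
    then obtain s where "h = act s" by auto
    then have "h = run [(s, True)]" by (simp add: fun_eq_iff)
    then show ?case ..
  next
    case (inv h)
    then obtain s where h: "h = act s" by auto
    have "inv\<^bsub>BijGroup UNIV\<^esub> h = run [(s, False)]"
      unfolding h inv_act by (simp add: fun_eq_iff)
    then show ?case ..
  next
    case (eng g h)
    then obtain u w where "g = run u" "h = run w" by auto
    then have "g \<otimes>\<^bsub>BijGroup UNIV\<^esub> h = run (u @ w)"
      using mult_BijGroup_UNIV[OF eng.hyps[THEN Bij]] by (simp add: fun_eq_iff run_append)
    then show ?case ..
  qed
  then show "carrier basilica \<subseteq> range run"
    by (auto simp: basilica_def)
  have letter: "apply_letter l \<in> ?G" for l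
  proof (cases l)
    case (Pair s fwd)
    have "act s \<in> ?G" by (rule generate.incl) simp
    moreover have "act_inv s \<in> ?G" using generate.inv[of "act s" "range act" "BijGroup UNIV"] by (simp add: inv_act)
    moreover have "apply_letter l = (if fwd then act s else act_inv s)"
      using Pair by (simp add: fun_eq_iff)
    ultimately show ?thesis by simp
  qed
  have "run w \<in> ?G" for w
  proof (induction w)
    case Nil
    have "run [] = id" by (simp add: fun_eq_iff)
    with generate.one[of "BijGroup UNIV" "range act"] show ?case
      unfolding one_BijGroup_UNIV by metis
  next
    case (Cons l w)
    have "run (l # w) = apply_letter l \<circ> run w" by (simp add: fun_eq_iff)
    with mult[OF letter Cons] show ?case by metis
  qed
  then show "range run \<subseteq> carrier basilica"
    by (auto simp: basilica_def)
qed

lemma basilica_orbit_eq: "basilica_orbit \<xi> = range (\<lambda>w. run w \<xi>)"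
  by (auto simp: basilica_orbit_def orbit_def basilica_carrier)

lemma orbit_refl: "\<xi> \<in> basilica_orbit \<xi>"
  unfolding basilica_orbit_eq by (rule range_eqI[of _ _ "[]"]) simp

lemma run_in_orbit: "x \<in> basilica_orbit \<xi> \<Longrightarrow> run w x \<in> basilica_orbit \<xi>"
  unfolding basilica_orbit_eq by (auto simp: run_append[symmetric])

lemma orbit_eq:
  assumes "v \<in> basilica_orbit \<xi>"
  shows "basilica_orbit v = basilica_orbit \<xi>"
proof -
  obtain w where v: "v = run w \<xi>" using assms by (auto simp: basilica_orbit_eq)
  then have \<xi>: "\<xi> \<in> basilica_orbit v" using run_invert unfolding basilica_orbit_eq by (metis rangeI)
  show ?thesis
  proof (intro equalityI subsetI)
    fix x assume "x \<in> basilica_orbit v"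
    then show "x \<in> basilica_orbit \<xi>" using run_in_orbit[OF assms] by (auto simp: basilica_orbit_eq)
  next
    fix x assume "x \<in> basilica_orbit \<xi>"
    then show "x \<in> basilica_orbit v" using run_in_orbit[OF \<xi>] by (auto simp: basilica_orbit_eq)
  qed
qed

lemma act_in_orbit: "x \<in> basilica_orbit \<xi> \<Longrightarrow> act s x \<in> basilica_orbit \<xi>"
  using run_in_orbit[of x \<xi> "[(s, True)]"] by simp

lemma act_inv_in_orbit: "x \<in> basilica_orbit \<xi> \<Longrightarrow> act_inv s x \<in> basilica_orbit \<xi>"
  using run_in_orbit[of x \<xi> "[(s, False)]"] by simp

lemma orbit_induct [consumes 1, case_names base act act_inv]:
  assumes "x \<in> basilica_orbit \<xi>" "P \<xi>"
    and "\<And>x s. x \<in> basilica_orbit \<xi> \<Longrightarrow> P x \<Longrightarrow> P (act s x)"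
    and "\<And>x s. x \<in> basilica_orbit \<xi> \<Longrightarrow> P x \<Longrightarrow> P (act_inv s x)"
  shows "P x"
proof -
  have "P (run w \<xi>)" for w
    by (induction w) (auto simp: assms basilica_orbit_eq)
  with assms(1) show ?thesis by (auto simp: basilica_orbit_eq)
qed


section \<open>The tree of cycles\<close>

text \<open>
  For such a word both generators have a pivot, also after the letters below any index have been
  erased, so that every vertex of its Schreier graph lies on two finite cycles.
\<close>

definition generic :: "word \<Rightarrow> bool" where
  "generic x \<longleftrightarrow> (\<forall>p N. \<exists>i\<ge>N. even i = p \<and> x !! i)"

lemma generic_cofinal:
  assumes "generic x" "\<And>i. N \<le> i \<Longrightarrow> x !! i = y !! i"
  shows "generic y"
  unfolding generic_def
proof (intro allI)
  fix p M
  obtain i where "i \<ge> max M N" "even i = p" "x !! i"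
    using assms(1) unfolding generic_def by blast
  then show "\<exists>i\<ge>M. even i = p \<and> y !! i"
    using assms(2)[of i] by auto
qed

lemma generic_same_cycle: "same_cycle n x y \<Longrightarrow> generic x \<longleftrightarrow> generic y"
  using generic_cofinal[of x n y] generic_cofinal[of y n x] by (auto simp: same_cycle_def)

lemma pivot_exists:
  assumes "generic x"
  obtains n where "pivot s n x"
proof -
  let ?P = "\<lambda>i. even i = (s = Gen_a) \<and> x !! i"
  have "\<exists>i. ?P i" using assms unfolding generic_def by blast
  then have "?P (LEAST i. ?P i)" by (rule LeastI_ex)
  moreover have "\<not> ?P j" if "j < (LEAST i. ?P i)" for j
    using not_less_Least[OF that] .
  ultimately have "pivot s (LEAST i. ?P i) x" by (auto simp: pivot_def)
  then show ?thesis ..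
qed

lemma generic_act: "generic (act s x) \<longleftrightarrow> generic x"
proof
  assume "generic x"
  then obtain n where "pivot s n x" by (rule pivot_exists)
  with \<open>generic x\<close> show "generic (act s x)"
    using same_cycle_act generic_same_cycle by blast
next
  assume "generic (act s x)"
  then obtain n where "pivot s n (act s x)" by (rule pivot_exists)
  with \<open>generic (act s x)\<close> show "generic x"
    using same_cycle_act generic_same_cycle pivot_act_iff by blast
qed

lemma generic_orbit: "x \<in> basilica_orbit \<xi> \<Longrightarrow> generic \<xi> \<Longrightarrow> generic x"
proof (induction rule: orbit_induct)
  case (act_inv x s)
  then show ?case using generic_act[of s "act_inv s x"] by (simp add: act_act_inv)
qed (simp_all add: generic_act)

definition lead :: "word \<Rightarrow> nat" where
  "lead x = (LEAST i. x !! i)"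

text \<open>
  The indices \<open>lead x\<close> and \<open>turn x\<close> are the pivots of the two generators at \<open>x\<close>. On the cycle
  that belongs to \<open>lead x\<close> the counter of \<open>x\<close> is 0. On the one that belongs to \<open>turn x\<close> it is not,
  because that counter reads the 1 at \<open>lead x\<close>.
\<close>

definition turn :: "word \<Rightarrow> nat" where
  "turn x = (LEAST i. even i \<noteq> even (lead x) \<and> x !! i)"

text \<open>
  The vertex with counter 0 on the cycle through \<open>x\<close> that belongs to \<open>turn x\<close>. Since
  \<open>lead (parent x) = turn x\<close>, every step to the parent passes to a longer cycle.
\<close>

definition parent :: "word \<Rightarrow> word" where
  "parent x = replicate (turn x) False @- sdrop (turn x) x"

definition gen_at :: "nat \<Rightarrow> gen" where
  "gen_at n = (if even n then Gen_a else Gen_b)"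

lemma parent_snth: "parent x !! i \<longleftrightarrow> turn x \<le> i \<and> x !! i"
  by (cases "i < turn x") (simp_all add: parent_def shift_snth_less shift_snth_ge sdrop_snth)

lemma lead_less: "i < lead x \<Longrightarrow> \<not> x !! i"
  unfolding lead_def by (rule not_less_Least)

lemma lead_eqI: "x !! n \<Longrightarrow> (\<And>i. i < n \<Longrightarrow> \<not> x !! i) \<Longrightarrow> lead x = n"
  unfolding lead_def by (rule Least_equality) (auto simp: not_less[symmetric])

lemma turn_less: "i < turn x \<Longrightarrow> even i = even (turn x) \<Longrightarrow> even (lead x) \<noteq> even (turn x) \<Longrightarrow> \<not> x !! i"
  unfolding turn_def using not_less_Least by blast

lemma turn_eqI:
  "even n \<noteq> even (lead x) \<Longrightarrow> x !! n \<Longrightarrow> (\<And>i. i < n \<Longrightarrow> even i \<noteq> even (lead x) \<Longrightarrow> \<not> x !! i) \<Longrightarrow> turn x = n"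
  unfolding turn_def by (rule Least_equality) (auto simp: not_less[symmetric])

context
  fixes x assumes x: "generic x"
begin

lemma lead_letter: "x !! lead x"
  using x unfolding generic_def lead_def by (metis LeastI)

lemma turn_letter: "even (turn x) \<noteq> even (lead x)" "x !! turn x"
proof -
  have "\<exists>i. even i \<noteq> even (lead x) \<and> x !! i"
    using x unfolding generic_def by (metis (full_types))
  then have "even (turn x) \<noteq> even (lead x) \<and> x !! turn x"
    unfolding turn_def by (rule LeastI_ex)
  then show "even (turn x) \<noteq> even (lead x)" "x !! turn x" by auto
qed

lemma lead_less_turn: "lead x < turn x"
  using lead_less[of "turn x" x] turn_letter by (metis linorder_neqE_nat)

lemma pivot_lead: "pivot (gen_at (lead x)) (lead x) x"
  using lead_letter lead_less by (auto simp: pivot_def gen_at_def)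

lemma pivot_turn: "pivot (gen_at (turn x)) (turn x) x"
  using turn_letter turn_less[of _ x] by (auto simp: pivot_def gen_at_def)

lemma lead_parent: "lead (parent x) = turn x"
  by (rule lead_eqI) (auto simp: parent_snth turn_letter)

lemma parent_neq: "parent x \<noteq> x"
  using lead_parent lead_less_turn by auto

lemma generic_parent: "generic (parent x)"
  using x by (rule generic_cofinal[of _ "turn x"]) (simp add: parent_snth)

lemma same_cycle_parent: "same_cycle (turn x) x (parent x)"
  using turn_letter turn_less[of _ x] by (auto simp: same_cycle_def parent_snth not_le[symmetric])

lemma pivot_unique:
  assumes "pivot s n x"
  shows "n = lead x \<or> n = turn x"
proof (cases "even n = even (lead x)")
  case True
  then show ?thesis
    using assms lead_letter lead_less[of n x] unfolding pivot_def by (metis linorder_neqE_nat)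
next
  case False
  then show ?thesis
    using assms turn_letter turn_less[of n x] unfolding pivot_def by (metis linorder_neqE_nat)
qed

end

text \<open>
  The children of \<open>p\<close> and \<open>p\<close> itself make up one cycle. Hence the number of children is a
  graph-theoretic trace of \<open>lead p\<close>.
\<close>

lemma children_iff:
  assumes p: "generic p"
  shows "generic q \<and> parent q = p \<longleftrightarrow> same_cycle (lead p) p q \<and> q \<noteq> p"
proof
  assume *: "generic q \<and> parent q = p"
  then show "same_cycle (lead p) p q \<and> q \<noteq> p"
    using same_cycle_parent[of q] same_cycle_sym lead_parent[of q] parent_neq[of q] by auto
next
  assume *: "same_cycle (lead p) p q \<and> q \<noteq> p"
  then have q: "generic q" using p generic_same_cycle by blast
  have "\<exists>i<lead p. q !! i"
  proof (rule ccontr)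
    assume "\<not> (\<exists>i<lead p. q !! i)"
    then have "q !! i = p !! i" for i
      using * lead_less[of i p] by (cases "i < lead p") (auto simp: same_cycle_def)
    then have "q = p" by (rule word_eqI)
    with * show False by simp
  qed
  then have less: "lead q < lead p" using lead_less by (meson linorder_not_less order.strict_trans1)
  have zero: "\<not> q !! i" if "i < lead p" "even i = even (lead p)" for i
    using * that lead_less[of i p] unfolding same_cycle_def by blast
  have parity: "even (lead q) \<noteq> even (lead p)"
    using zero less lead_letter[OF q] by blast
  have "turn q = lead p"
    using parity zero * lead_letter[OF p] by (intro turn_eqI) (auto simp: same_cycle_def)
  then have "parent q = p"
    using * lead_less[of _ p] unfolding same_cycle_def by (intro word_eqI) (auto simp: parent_snth not_le[symmetric])
  with q show "generic q \<and> parent q = p" by simp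
qed

lemma card_children:
  assumes p: "generic p"
  shows "card {q. generic q \<and> parent q = p} = 2 ^ (Suc (lead p) div 2) - 1"
proof -
  have card: "card {q. same_cycle (lead p) p q} = 2 ^ (Suc (lead p) div 2)"
    using card_same_cycle[OF pivot_lead[OF p]] .
  have "{q. generic q \<and> parent q = p} = {q. same_cycle (lead p) p q} - {p}"
    using children_iff[OF p] by auto
  then show ?thesis
    by (simp add: card same_cycle_refl)
qed

definition adjacent :: "word \<Rightarrow> word \<Rightarrow> bool" where
  "adjacent x y \<longleftrightarrow> (\<exists>s. y = act s x \<or> x = act s y)"

lemma adjacent_act: "adjacent x (act s x)" "adjacent x (act_inv s x)"
  unfolding adjacent_def by (metis act_act_inv)+

text \<open>
  A generator moves \<open>x\<close> along one of its two cycles: on one of them the other vertices are the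
  children of \<open>x\<close>, on the other one they are the parent and the siblings of \<open>x\<close>.
\<close>

lemma adjacent_parent:
  assumes "generic x" "adjacent x y"
  shows "y = x \<or> parent y = x \<or> parent x = y \<or> parent x = parent y"
proof -
  have step: "act s x = x \<or> parent (act s x) = x \<or> parent x = act s x \<or> parent x = parent (act s x)"
    if x: "generic x" for s x
  proof -
    obtain n where n: "pivot s n x" using x by (rule pivot_exists)
    have cyc: "same_cycle n x (act s x)" using n by (rule same_cycle_act)
    from pivot_unique[OF x n] show ?thesis
    proof
      assume "n = lead x"
      then show ?thesis using children_iff[OF x] cyc by blast
    next
      assume "n = turn x"
      then have "same_cycle (lead (parent x)) (parent x) (act s x)"
        using cyc same_cycle_parent[OF x] lead_parent[OF x] by (simp add: same_cycle_def)
      then show ?thesis using children_iff[OF generic_parent[OF x]] by metis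
    qed
  qed
  show ?thesis
    using assms step[of x] step[of y] generic_act unfolding adjacent_def by metis
qed

lemma counter_parent: "counter (turn x) (parent x) = 0"
  by (rule counter_eq_0) (simp add: parent_snth)

text \<open>
  The next two lemmas are the two ways around the cycle from \<open>x\<close> to its parent: by decreasing
  the counter down to 0, or by increasing it until it wraps around to 0. Each way visits only
  vertices whose counter is on one side of that of \<open>x\<close>, so a single vertex other than \<open>x\<close> and its
  parent blocks at most one of the two.
\<close>

lemma walk_down:
  assumes x: "generic x" "x \<in> S"
    and step: "\<And>z. z \<in> S \<Longrightarrow> same_cycle (turn x) x z \<Longrightarrow> 0 < counter (turn x) z \<Longrightarrow>
      counter (turn x) z \<le> counter (turn x) x \<Longrightarrow> act (gen_at (turn x)) z \<in> S"
  shows "parent x \<in> S"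
proof -
  let ?n = "turn x"
  have "parent x \<in> S" if "z \<in> S" "same_cycle ?n x z" "counter ?n z \<le> counter ?n x" for z
    using that
  proof (induction "counter ?n z" arbitrary: z)
    case 0
    then have "z = parent x"
      using counter_inj[of ?n z "parent x"] same_cycle_parent[OF x(1)] counter_parent[of x]
      by (simp add: same_cycle_def)
    with 0 show ?case by simp
  next
    case (Suc k)
    have piv: "pivot (gen_at ?n) ?n z"
      using Suc pivot_turn[OF x(1)] pivot_same_cycle by blast
    have "counter ?n (act (gen_at ?n) z) = k"
      using counter_act[OF piv] Suc by simp
    moreover have "same_cycle ?n x (act (gen_at ?n) z)"
      using Suc.prems same_cycle_act[OF piv] same_cycle_trans by blast
    ultimately show ?case
      using Suc.hyps(1)[of "act (gen_at ?n) z"] Suc.hyps(2) Suc.prems step[of z] by simp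
  qed
  then show ?thesis using x same_cycle_refl by blast
qed

lemma walk_up:
  assumes x: "generic x" "x \<in> S"
    and step: "\<And>z. z \<in> S \<Longrightarrow> same_cycle (turn x) x z \<Longrightarrow>
      counter (turn x) x \<le> counter (turn x) z \<Longrightarrow> act_inv (gen_at (turn x)) z \<in> S"
  shows "parent x \<in> S"
proof -
  let ?n = "turn x"
  have "parent x \<in> S" if "z \<in> S" "same_cycle ?n x z" "counter ?n x \<le> counter ?n z" for z
    using that
  proof (induction "2 ^ (Suc ?n div 2) - counter ?n z" arbitrary: z rule: less_induct)
    case less
    define y where "y = act_inv (gen_at ?n) z"
    have z: "z = act (gen_at ?n) y" by (simp add: y_def act_act_inv)
    have piv: "pivot (gen_at ?n) ?n y"
      using less.prems pivot_turn[OF x(1)] pivot_same_cycle pivot_act_iff z by blast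
    have yS: "y \<in> S" using less.prems step y_def by blast
    have cyc: "same_cycle ?n x y"
      using less.prems(2) same_cycle_act[OF piv] z by (simp add: same_cycle_def)
    show ?case
    proof (cases "counter ?n y = 0")
      case True
      have "same_cycle ?n y (parent x)"
        using cyc same_cycle_parent[OF x(1)] same_cycle_sym same_cycle_trans by blast
      then have "y = parent x"
        by (rule counter_inj) (simp add: True counter_parent)
      with yS show ?thesis by blast
    next
      case False
      then have "counter ?n y = Suc (counter ?n z)"
        using counter_act[OF piv] unfolding z[symmetric] by simp
      then show ?thesis
        using less.hyps[of y] less.prems(3) cyc yS counter_less[of ?n y] by simp
    qed
  qed
  then show ?thesis using x same_cycle_refl by blast
qed

lemma parent_in_orbit: "generic x \<Longrightarrow> x \<in> basilica_orbit \<xi> \<Longrightarrow> parent x \<in> basilica_orbit \<xi>"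
  by (rule walk_down) (auto intro: act_in_orbit)

lemma parent_in_orbit_iff:
  assumes x: "generic x"
  shows "parent x \<in> basilica_orbit \<xi> \<longleftrightarrow> x \<in> basilica_orbit \<xi>"
proof -
  have "basilica_orbit (parent x) = basilica_orbit x"
    using orbit_eq[OF parent_in_orbit[OF x orbit_refl]] .
  then show ?thesis
    using orbit_eq[of "parent x" \<xi>] orbit_eq[of x \<xi>] orbit_refl by metis
qed


section \<open>Isomorphisms respect the tree of cycles\<close>

definition descendants :: "word \<Rightarrow> word set" where
  "descendants p = {q. \<exists>n. (parent ^^ n) q = p}"

lemma descendants_refl: "p \<in> descendants p"
  unfolding descendants_def by (auto intro: exI[of _ 0])

lemma descendants_parent: "parent q \<in> descendants p \<Longrightarrow> q \<in> descendants p"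
  unfolding descendants_def by (auto simp: funpow_swap1[symmetric] intro: exI[of _ "Suc n" for n])

lemma parent_descendants:
  assumes "q \<in> descendants p" "q \<noteq> p"
  shows "parent q \<in> descendants p"
proof -
  obtain n where "(parent ^^ n) q = p" using assms by (auto simp: descendants_def)
  moreover from this assms obtain m where "n = Suc m" by (cases n) auto
  ultimately have "(parent ^^ m) (parent q) = p" by (simp add: funpow_swap1)
  then show ?thesis by (auto simp: descendants_def)
qed

lemma generic_ancestor: "generic x \<Longrightarrow> generic ((parent ^^ n) x)"
  by (induction n) (auto simp: generic_parent)

lemma ancestor_in_orbit:
  "generic x \<Longrightarrow> x \<in> basilica_orbit \<xi> \<Longrightarrow> (parent ^^ n) x \<in> basilica_orbit \<xi>"
  by (induction n) (auto simp: parent_in_orbit generic_ancestor)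

lemma strict_mono_lead_ancestor:
  assumes "generic x"
  shows "strict_mono (\<lambda>n. lead ((parent ^^ n) x))"
  using generic_ancestor[OF assms] lead_parent lead_less_turn
  by (auto simp: strict_mono_Suc_iff)

lemma descendants_antisym:
  assumes "generic x" "y \<in> descendants x" "x \<in> descendants y"
  shows "x = y"
proof -
  obtain m n where "(parent ^^ m) x = y" "(parent ^^ n) y = x"
    using assms(2,3) unfolding descendants_def by auto
  then have "lead ((parent ^^ (n + m)) x) = lead ((parent ^^ 0) x)"
    by (simp add: funpow_add)
  then have "n + m = 0"
    using strict_mono_lead_ancestor[OF assms(1)] by (metis strict_mono_eq)
  with \<open>(parent ^^ m) x = y\<close> show ?thesis by simp
qed

text \<open>
  Passing to the parent erases letters, and only below the new \<open>lead\<close>. So a descendant of \<open>p\<close> is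
  determined by its finitely many letters below \<open>lead p\<close>.
\<close>

lemma descendants_agree:
  assumes "generic q" "(parent ^^ n) q = p" "lead p \<le> i"
  shows "q !! i = p !! i"
  using assms
proof (induction n arbitrary: q)
  case 0
  then show ?case by simp
next
  case (Suc n)
  have anc: "(parent ^^ n) (parent q) = p" using Suc.prems by (simp add: funpow_swap1)
  have "lead (parent q) \<le> lead p"
    using strict_mono_less_eq[OF strict_mono_lead_ancestor[OF generic_parent[OF Suc.prems(1)]], of 0 n] anc
    by simp
  then have "turn q \<le> i" using lead_parent[OF Suc.prems(1)] Suc.prems by simp
  then show ?case
    using Suc.IH[OF generic_parent[OF Suc.prems(1)] anc Suc.prems(3)] by (simp add: parent_snth)
qed

lemma finite_descendants: "finite {q \<in> descendants p. generic q}"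
proof (rule finite_subset)
  let ?L = "{l :: bool list. set l \<subseteq> UNIV \<and> length l = lead p}"
  show "{q \<in> descendants p. generic q} \<subseteq> (\<lambda>l. l @- sdrop (lead p) p) ` ?L"
  proof
    fix q assume "q \<in> {q \<in> descendants p. generic q}"
    then obtain n where n: "generic q" "(parent ^^ n) q = p"
      by (auto simp: descendants_def)
    have "sdrop (lead p) q = sdrop (lead p) p"
      by (rule word_eqI) (simp add: sdrop_snth descendants_agree[OF n])
    then have "q = stake (lead p) q @- sdrop (lead p) p" by (metis stake_sdrop)
    then show "q \<in> (\<lambda>l. l @- sdrop (lead p) p) ` ?L"
      by (rule image_eqI) simp
  qed
  show "finite ((\<lambda>l. l @- sdrop (lead p) p) ` ?L)"
    by (intro finite_imageI finite_lists_length_eq) simp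
qed

text \<open>
  A finite piece of the graph attached at the single vertex \<open>p\<close>. This notion only uses
  adjacency, so isomorphisms respect it.
\<close>

definition bud :: "word set \<Rightarrow> word set \<Rightarrow> word \<Rightarrow> bool" where
  "bud V D p \<longleftrightarrow> finite D \<and> D \<subseteq> V \<and> p \<in> D \<and> (\<forall>x\<in>D - {p}. \<forall>y\<in>V. adjacent x y \<longrightarrow> y \<in> D)"

text \<open>
  An edge between a descendant of \<open>p\<close> and a non-descendant can only start at \<open>p\<close>, since the two ends
  of an edge are siblings or parent and child.
\<close>

lemma bud_descendants:
  assumes \<xi>: "generic \<xi>" and p: "p \<in> basilica_orbit \<xi>"
  shows "bud (basilica_orbit \<xi>) (descendants p \<inter> basilica_orbit \<xi>) p"
  unfolding bud_def
proof (intro conjI ballI impI)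
  have "descendants p \<inter> basilica_orbit \<xi> \<subseteq> {q \<in> descendants p. generic q}"
    using generic_orbit \<xi> by auto
  then show "finite (descendants p \<inter> basilica_orbit \<xi>)"
    using finite_descendants finite_subset by blast
next
  fix x y assume x: "x \<in> descendants p \<inter> basilica_orbit \<xi> - {p}"
    and y: "y \<in> basilica_orbit \<xi>" "adjacent x y"
  have "generic x" using x \<xi> generic_orbit by blast
  have "parent x \<in> descendants p" using x parent_descendants by blast
  then show "y \<in> descendants p \<inter> basilica_orbit \<xi>"
    using adjacent_parent[OF \<open>generic x\<close> y(2)] x y(1) descendants_parent by auto
qed (use p descendants_refl in auto)

text \<open>
  From a vertex \<open>x \<noteq> p\<close> of a bud at \<open>p\<close> the parent of \<open>x\<close> is reached on the way around their cycle
  that avoids \<open>p\<close>, so it is in the bud as well. If \<open>x\<close> were no descendant of \<open>p\<close>, then \<open>p\<close> would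
  never be met and the bud would contain all of the infinitely many ancestors of \<open>x\<close>.
\<close>

lemma bud_subset_descendants:
  assumes \<xi>: "generic \<xi>" and D: "bud (basilica_orbit \<xi>) D p"
  shows "D \<subseteq> descendants p"
proof
  fix q assume "q \<in> D"
  have V: "D \<subseteq> basilica_orbit \<xi>" and gen: "\<And>x. x \<in> D \<Longrightarrow> generic x"
    using D \<xi> generic_orbit unfolding bud_def by blast+
  have closed: "y \<in> D" if "x \<in> D" "x \<noteq> p" "adjacent x y" "y \<in> basilica_orbit \<xi>" for x y
    using that D unfolding bud_def by blast
  have up: "parent x \<in> D" if x: "x \<in> D" "x \<noteq> p" for x
  proof (cases "same_cycle (turn x) x p \<and> counter (turn x) p < counter (turn x) x")
    case True
    show ?thesis
    proof (rule walk_up[OF gen[OF x(1)] x(1)])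
      fix z assume z: "z \<in> D" "counter (turn x) x \<le> counter (turn x) z"
      then have "z \<noteq> p" using True by auto
      then show "act_inv (gen_at (turn x)) z \<in> D"
        using closed z(1) adjacent_act V act_inv_in_orbit by blast
    qed
  next
    case False
    have "p \<noteq> x" using x by simp
    show ?thesis
    proof (rule walk_down[OF gen[OF x(1)] x(1)])
      fix z assume z: "z \<in> D" "same_cycle (turn x) x z" "counter (turn x) z \<le> counter (turn x) x"
      have "z \<noteq> p"
      proof
        assume "z = p"
        then have "same_cycle (turn x) x p" "counter (turn x) p = counter (turn x) x"
          using False z by auto
        then have "x = p" by (simp add: counter_inj)
        with x show False by simp
      qed
      then show "act (gen_at (turn x)) z \<in> D"
        using closed z(1) adjacent_act V act_in_orbit by blast
    qed
  qed
  show "q \<in> descendants p"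
  proof (rule ccontr)
    assume q: "q \<notin> descendants p"
    have "(parent ^^ n) q \<in> D" for n
    proof (induction n)
      case 0
      with \<open>q \<in> D\<close> show ?case by simp
    next
      case (Suc n)
      have "(parent ^^ n) q \<noteq> p" using q by (auto simp: descendants_def)
      with Suc show ?case by (simp add: up)
    qed
    then have "range (\<lambda>n. (parent ^^ n) q) \<subseteq> D" by auto
    moreover have "inj (\<lambda>n. (parent ^^ n) q)"
      by (rule injI) (metis strict_mono_eq[OF strict_mono_lead_ancestor[OF gen[OF \<open>q \<in> D\<close>]]])
    ultimately have "infinite D" using finite_subset finite_imageD infinite_UNIV_nat by metis
    with D show False by (simp add: bud_def)
  qed
qed

lemma descendants_iff_bud:
  assumes "generic \<xi>" "p \<in> basilica_orbit \<xi>" "q \<in> basilica_orbit \<xi>"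
  shows "q \<in> descendants p \<longleftrightarrow> (\<exists>D. bud (basilica_orbit \<xi>) D p \<and> q \<in> D)"
  using bud_descendants[OF assms(1,2)] bud_subset_descendants[OF assms(1)] assms(3) by blast

text \<open>
  Forgetting edge multiplicities keeps enough of an isomorphism for the measure estimate.
\<close>

definition adjacency_iso :: "(word \<Rightarrow> word) \<Rightarrow> word \<Rightarrow> word \<Rightarrow> bool" where
  "adjacency_iso \<phi> \<xi> \<eta> \<longleftrightarrow> bij_betw \<phi> (basilica_orbit \<xi>) (basilica_orbit \<eta>) \<and>
     (\<forall>x\<in>basilica_orbit \<xi>. \<forall>y\<in>basilica_orbit \<xi>. adjacent (\<phi> x) (\<phi> y) \<longleftrightarrow> adjacent x y)"

lemma adjacency_iso_inv:
  assumes "adjacency_iso \<phi> \<xi> \<eta>"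
  shows "adjacency_iso (inv_into (basilica_orbit \<xi>) \<phi>) \<eta> \<xi>"
  unfolding adjacency_iso_def
proof (intro conjI ballI)
  let ?\<psi> = "inv_into (basilica_orbit \<xi>) \<phi>"
  have bij: "bij_betw \<phi> (basilica_orbit \<xi>) (basilica_orbit \<eta>)"
    using assms by (simp add: adjacency_iso_def)
  then show bij': "bij_betw ?\<psi> (basilica_orbit \<eta>) (basilica_orbit \<xi>)" by (rule bij_betw_inv_into)
  fix x y assume xy: "x \<in> basilica_orbit \<eta>" "y \<in> basilica_orbit \<eta>"
  then have "?\<psi> x \<in> basilica_orbit \<xi>" "?\<psi> y \<in> basilica_orbit \<xi>" using bij' bij_betwE by blast+
  moreover have "\<phi> (?\<psi> x) = x" "\<phi> (?\<psi> y) = y" using xy bij by (simp_all add: bij_betw_inv_into_right)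
  ultimately show "adjacent (?\<psi> x) (?\<psi> y) \<longleftrightarrow> adjacent x y"
    using assms unfolding adjacency_iso_def by metis
qed

lemma adjacency_iso_bud:
  assumes "adjacency_iso \<phi> \<xi> \<eta>" "bud (basilica_orbit \<xi>) D p"
  shows "bud (basilica_orbit \<eta>) (\<phi> ` D) (\<phi> p)"
  unfolding bud_def
proof (intro conjI ballI impI)
  have bij: "bij_betw \<phi> (basilica_orbit \<xi>) (basilica_orbit \<eta>)"
    using assms by (simp add: adjacency_iso_def)
  show "\<phi> ` D \<subseteq> basilica_orbit \<eta>"
    using assms(2) bij by (auto simp: bud_def dest: bij_betwE)
  fix x y assume x: "x \<in> \<phi> ` D - {\<phi> p}" and y: "y \<in> basilica_orbit \<eta>" "adjacent x y"
  obtain u where u: "x = \<phi> u" "u \<in> D - {p}" using x by blast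
  obtain v where v: "y = \<phi> v" "v \<in> basilica_orbit \<xi>"
    using y(1) bij by (auto simp: bij_betw_def)
  have "u \<in> basilica_orbit \<xi>" using u assms(2) by (auto simp: bud_def)
  then have "adjacent u v" using y(2) u v assms(1) by (simp add: adjacency_iso_def)
  then have "v \<in> D" using u v assms(2) by (simp add: bud_def)
  then show "y \<in> \<phi> ` D" using v by simp
qed (use assms in \<open>auto simp: bud_def\<close>)

lemma adjacency_iso_descendants:
  assumes "generic \<xi>" "generic \<eta>" "adjacency_iso \<phi> \<xi> \<eta>" "p \<in> basilica_orbit \<xi>" "q \<in> basilica_orbit \<xi>"
    and "q \<in> descendants p"
  shows "\<phi> q \<in> descendants (\<phi> p)"
proof -
  have "\<phi> p \<in> basilica_orbit \<eta>" "\<phi> q \<in> basilica_orbit \<eta>"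
    using assms unfolding adjacency_iso_def by (auto dest: bij_betwE)
  then show ?thesis
    using assms descendants_iff_bud adjacency_iso_bud by (meson imageI)
qed

text \<open>
  By \<open>descendants_iff_bud\<close> an isomorphism preserves the descendant order, and the parent of \<open>x\<close> is
  the least proper ancestor of \<open>x\<close> in that order.
\<close>

lemma adjacency_iso_parent:
  assumes \<xi>: "generic \<xi>" and \<eta>: "generic \<eta>" and \<phi>: "adjacency_iso \<phi> \<xi> \<eta>" and x: "x \<in> basilica_orbit \<xi>"
  shows "\<phi> (parent x) = parent (\<phi> x)"
proof -
  \<comment> \<open>The vertex \<open>u\<close> below is the preimage of \<open>parent (\<phi> x)\<close>; it lies between \<open>x\<close> and \<open>parent x\<close>.\<close>
  define \<psi> where "\<psi> = inv_into (basilica_orbit \<xi>) \<phi>"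
  have bij: "bij_betw \<phi> (basilica_orbit \<xi>) (basilica_orbit \<eta>)"
    using \<phi> by (simp add: adjacency_iso_def)
  have \<psi>: "adjacency_iso \<psi> \<eta> \<xi>" using adjacency_iso_inv[OF \<phi>] by (simp add: \<psi>_def)
  have \<psi>\<phi>: "\<psi> (\<phi> z) = z" if "z \<in> basilica_orbit \<xi>" for z
    using bij that by (simp add: \<psi>_def bij_betw_inv_into_left)
  have \<phi>x: "\<phi> x \<in> basilica_orbit \<eta>" using bij x by (auto dest: bij_betwE)
  have gen: "generic x" "generic (\<phi> x)" using x \<phi>x \<xi> \<eta> generic_orbit by blast+
  have px: "parent x \<in> basilica_orbit \<xi>" "parent (\<phi> x) \<in> basilica_orbit \<eta>"
    using gen x \<phi>x parent_in_orbit by blast+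
  obtain u where u: "u \<in> basilica_orbit \<xi>" "\<phi> u = parent (\<phi> x)"
    using bij px(2) by (metis bij_betw_iff_bijections)
  have "\<phi> x \<in> descendants (\<phi> (parent x))"
    using adjacency_iso_descendants[OF \<xi> \<eta> \<phi> px(1) x] descendants_parent descendants_refl by blast
  moreover have "\<phi> x \<noteq> \<phi> (parent x)"
    using parent_neq[OF gen(1)] \<psi>\<phi> x px(1) by metis
  ultimately have "\<phi> u \<in> descendants (\<phi> (parent x))"
    using parent_descendants u(2) by metis
  then have below: "u \<in> descendants (parent x)"
    using adjacency_iso_descendants[OF \<eta> \<xi> \<psi>, of "\<phi> (parent x)" "\<phi> u"] \<psi>\<phi> px u(1) bij
    by (metis bij_betwE u(2))
  have "\<phi> x \<in> descendants (\<phi> u)"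
    using u(2) descendants_parent descendants_refl by metis
  then have "x \<in> descendants u"
    using adjacency_iso_descendants[OF \<eta> \<xi> \<psi>, of "\<phi> u" "\<phi> x"] \<psi>\<phi> u x \<phi>x px by metis
  moreover have "x \<noteq> u"
    using u(2) parent_neq[OF gen(2)] by auto
  ultimately have "parent x \<in> descendants u" by (rule parent_descendants)
  with below have "parent x = u"
    using descendants_antisym generic_parent[OF gen(1)] by blast
  with u show ?thesis by simp
qed

lemma adjacency_iso_ancestor:
  assumes \<xi>: "generic \<xi>" and \<eta>: "generic \<eta>" and \<phi>: "adjacency_iso \<phi> \<xi> \<eta>" and x: "x \<in> basilica_orbit \<xi>"
  shows "\<phi> ((parent ^^ n) x) = (parent ^^ n) (\<phi> x)"
  by (induction n)
    (simp_all add: adjacency_iso_parent[OF \<xi> \<eta> \<phi>] ancestor_in_orbit[OF generic_orbit[OF x \<xi>] x])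

text \<open>
  Isomorphisms preserve the number \<open>2 ^ (Suc (lead p) div 2) - 1\<close> of children of \<open>p\<close>.
\<close>

lemma adjacency_iso_lead:
  assumes \<xi>: "generic \<xi>" and \<eta>: "generic \<eta>" and \<phi>: "adjacency_iso \<phi> \<xi> \<eta>" and p: "p \<in> basilica_orbit \<xi>"
  shows "Suc (lead (\<phi> p)) div 2 = Suc (lead p) div 2"
proof -
  have bij: "bij_betw \<phi> (basilica_orbit \<xi>) (basilica_orbit \<eta>)"
    using \<phi> by (simp add: adjacency_iso_def)
  then have \<phi>p: "\<phi> p \<in> basilica_orbit \<eta>" using p by (auto dest: bij_betwE)
  have in_orbit: "{q. generic q \<and> parent q = r} = {q \<in> basilica_orbit \<zeta>. parent q = r}"
    if "generic \<zeta>" "r \<in> basilica_orbit \<zeta>" for r \<zeta>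
    using that parent_in_orbit_iff generic_orbit by blast
  have image: "\<phi> ` {q \<in> basilica_orbit \<xi>. parent q = p} = {q \<in> basilica_orbit \<eta>. parent q = \<phi> p}"
  proof (intro equalityI subsetI)
    fix y assume "y \<in> {q \<in> basilica_orbit \<eta>. parent q = \<phi> p}"
    then have y: "y \<in> basilica_orbit \<eta>" "parent y = \<phi> p" by auto
    then obtain q where q: "q \<in> basilica_orbit \<xi>" "y = \<phi> q"
      using bij by (auto simp: bij_betw_def)
    then have "\<phi> (parent q) = \<phi> p" using y adjacency_iso_parent[OF \<xi> \<eta> \<phi>] by simp
    moreover have "parent q \<in> basilica_orbit \<xi>" using q generic_orbit[OF _ \<xi>] parent_in_orbit by blast
    ultimately have "parent q = p" using bij p by (auto simp: bij_betw_def inj_on_def)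
    with q show "y \<in> \<phi> ` {q \<in> basilica_orbit \<xi>. parent q = p}" by blast
  qed (use bij adjacency_iso_parent[OF \<xi> \<eta> \<phi>, symmetric] in \<open>auto dest: bij_betwE\<close>)
  have inj: "inj_on \<phi> {q \<in> basilica_orbit \<xi>. parent q = p}"
    using bij by (auto simp: bij_betw_def intro: inj_on_subset)
  have "card {q \<in> basilica_orbit \<eta>. parent q = \<phi> p} = card {q \<in> basilica_orbit \<xi>. parent q = p}"
    using card_image[OF inj] unfolding image .
  then have "card {q. generic q \<and> parent q = \<phi> p} = card {q. generic q \<and> parent q = p}"
    unfolding in_orbit[OF \<xi> p] in_orbit[OF \<eta> \<phi>p] .
  then have "(2::nat) ^ (Suc (lead p) div 2) - 1 = 2 ^ (Suc (lead (\<phi> p)) div 2) - 1"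
    using card_children[OF generic_orbit[OF p \<xi>]] card_children[OF generic_orbit[OF \<phi>p \<eta>]] by simp
  moreover have "(1::nat) \<le> 2 ^ (Suc (lead p) div 2)" "(1::nat) \<le> 2 ^ (Suc (lead (\<phi> p)) div 2)"
    by (rule one_le_power; simp)+
  ultimately have "(2::nat) ^ (Suc (lead p) div 2) = 2 ^ (Suc (lead (\<phi> p)) div 2)" by linarith
  then show ?thesis by simp
qed

lemma common_ancestor:
  assumes \<xi>: "generic \<xi>" and x: "x \<in> basilica_orbit \<xi>"
  shows "\<exists>i j. (parent ^^ i) x = (parent ^^ j) \<xi>"
proof -
  have step: "\<exists>i j. (parent ^^ i) y = (parent ^^ j) \<xi>"
    if z: "generic z" "adjacent z y" "(parent ^^ i) z = (parent ^^ j) \<xi>" for y z i j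
  proof -
    have shifted: "(parent ^^ i) (parent z) = (parent ^^ Suc j) \<xi>"
      using z(3) by (simp add: funpow_swap1[symmetric])
    from adjacent_parent[OF z(1,2)] consider
      "y = z" | "parent y = z" | "parent z = y" | "parent z = parent y" by blast
    then show ?thesis
    proof cases
      case 1
      then show ?thesis using z(3) by blast
    next
      case 2
      then have "(parent ^^ Suc i) y = (parent ^^ j) \<xi>" using z(3) by (simp add: funpow_swap1)
      then show ?thesis by blast
    next
      case 3
      then show ?thesis using shifted by blast
    next
      case 4
      then have "(parent ^^ Suc i) y = (parent ^^ Suc j) \<xi>" using shifted by (simp add: funpow_swap1)
      then show ?thesis by blast
    qed
  qed
  show ?thesis
    using x
  proof (induction rule: orbit_induct)
    case base
    show ?case by (rule exI[of _ 0]) blast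
  next
    case (act x s)
    then show ?case using step adjacent_act generic_orbit \<xi> by blast
  next
    case (act_inv x s)
    then show ?case using step adjacent_act generic_orbit \<xi> by blast
  qed
qed

text \<open>
  The numbers 1 and 2, 3 and 4, 5 and 6, ... are exchanged: these are the pairs of indices that
  \<open>adjacency_iso_lead\<close> cannot tell apart. The index 0, which has no partner, is fixed by the truncated
  subtraction.
\<close>

definition other_index :: "nat \<Rightarrow> nat" where
  "other_index l = (if even l then l - 1 else l + 1)"

lemma half_index_cases:
  assumes "Suc m div 2 = Suc l div 2"
  shows "m = (if even m = even l then l else other_index l)"
  using assms unfolding other_index_def by (auto elim!: evenE oddE)

text \<open>
  The sequences of \<open>lead\<close>s of the ancestors of \<open>\<xi>\<close> and of \<open>\<eta>\<close> agree, after shifts, up to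
  \<open>other_index\<close>. Along both sequences the parity alternates, so the choice between the two indices
  is the same everywhere. The word \<open>\<eta>\<close> has the letter 1 at all indices of its own sequence.
\<close>

lemma isomorphic_common_letters:
  assumes \<xi>: "generic \<xi>" and \<eta>: "generic \<eta>" and \<phi>: "adjacency_iso \<phi> \<xi> \<eta>"
  shows "\<exists>i. (\<forall>n. \<eta> !! lead ((parent ^^ (i + n)) \<xi>)) \<or> (\<forall>n. \<eta> !! other_index (lead ((parent ^^ (i + n)) \<xi>)))"
proof -
  have "\<phi> \<xi> \<in> basilica_orbit \<eta>"
    using \<phi> orbit_refl unfolding adjacency_iso_def by (auto dest: bij_betwE)
  \<comment> \<open>The image of the vertex \<open>\<xi>\<close> need not be \<open>\<eta>\<close>, but the two have a common ancestor.\<close>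
  then obtain i j where ij: "(parent ^^ i) (\<phi> \<xi>) = (parent ^^ j) \<eta>"
    using common_ancestor[OF \<eta>] by blast
  define l where "l n = lead ((parent ^^ (i + n)) \<xi>)" for n
  define m where "m n = lead ((parent ^^ (j + n)) \<eta>)" for n
  have half: "Suc (m n) div 2 = Suc (l n) div 2" for n
  proof -
    have "\<phi> ((parent ^^ (i + n)) \<xi>) = (parent ^^ (n + i)) (\<phi> \<xi>)"
      using adjacency_iso_ancestor[OF \<xi> \<eta> \<phi> orbit_refl] by (simp add: add.commute)
    also have "\<dots> = (parent ^^ (j + n)) \<eta>"
      by (simp add: funpow_add ij add.commute[of j])
    finally show ?thesis
      using adjacency_iso_lead[OF \<xi> \<eta> \<phi> ancestor_in_orbit[OF \<xi> orbit_refl], of "i + n"]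
      by (simp add: l_def m_def)
  qed
  have alternate: "even (lead ((parent ^^ Suc n) x)) \<noteq> even (lead ((parent ^^ n) x))" if "generic x" for n x
    using lead_parent turn_letter(1) generic_ancestor[OF that] by simp
  have parity: "(even (m n) = even (l n)) = (even (m 0) = even (l 0))" for n
    using alternate[OF \<xi>, of "i + n" for n] alternate[OF \<eta>, of "j + n" for n]
    by (induction n) (auto simp: l_def m_def)
  have letter: "\<eta> !! m n" for n
  proof -
    have "(parent ^^ (j + n)) \<eta> !! m n"
      unfolding m_def using lead_letter generic_ancestor[OF \<eta>] .
    then show ?thesis
      using descendants_agree[OF \<eta> refl, of "j + n" "m n"] by (simp add: m_def)
  qed
  have "m n = (if even (m 0) = even (l 0) then l n else other_index (l n))" for n
    using half_index_cases[OF half] parity[of n] by metis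
  then show ?thesis
    using letter unfolding l_def by metis
qed


section \<open>Isomorphism classes are contained in null sets\<close>

lemma space_uniform_word_measure [simp]: "space uniform_word_measure = UNIV"
  by (simp add: uniform_word_measure_def space_stream_space)

lemma measurable_letter [measurable]:
  "(\<lambda>x. x !! i) \<in> measurable uniform_word_measure (count_space UNIV)"
proof -
  let ?M = "measure_pmf (bernoulli_pmf (1/2))"
  have "measurable uniform_word_measure (count_space UNIV) = measurable (stream_space ?M) ?M"
    by (rule measurable_cong_sets) (simp_all add: uniform_word_measure_def)
  then show ?thesis using measurable_snth[of i ?M] by blast
qed

text \<open>
  By independence every prescribed letter contributes a factor 1/2. The induction splits off the
  first letter.
\<close>

lemma emeasure_prescribed_letters:
  "emeasure uniform_word_measure {x. \<forall>i<N. i \<in> S \<longrightarrow> x !! i = c} = ennreal ((1/2) ^ card (S \<inter> {..<N}))"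
proof (induction N arbitrary: S)
  case 0
  interpret prob_space uniform_word_measure
    unfolding uniform_word_measure_def
    by (rule prob_space.prob_space_stream_space[OF measure_pmf.prob_space_axioms])
  show ?case using emeasure_space_1 by simp
next
  case (Suc N)
  let ?M = "measure_pmf (bernoulli_pmf (1/2))"
  let ?T = "{i. Suc i \<in> S}"
  let ?p = "ennreal ((1/2) ^ card (?T \<inter> {..<N}))"
  have sets: "{x. \<forall>i<Suc N. i \<in> S \<longrightarrow> x !! i = c} \<in> sets (stream_space ?M)"
  proof -
    have "{x \<in> space uniform_word_measure. \<forall>i<Suc N. i \<in> S \<longrightarrow> x !! i = c} \<in> sets uniform_word_measure"
      by measurable
    then show ?thesis by (simp add: uniform_word_measure_def space_stream_space)
  qed
  have "emeasure uniform_word_measure {x. \<forall>i<Suc N. i \<in> S \<longrightarrow> x !! i = c} =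
     (\<integral>\<^sup>+t. emeasure uniform_word_measure {x. t ## x \<in> {x. \<forall>i<Suc N. i \<in> S \<longrightarrow> x !! i = c}} \<partial>?M)"
    using prob_space.emeasure_stream_space[OF measure_pmf.prob_space_axioms sets]
    by (simp add: uniform_word_measure_def space_stream_space)
  also have "\<dots> = (\<integral>\<^sup>+t. ?p * indicator (if 0 \<in> S then {c} else UNIV) t \<partial>?M)"
    by (intro nn_integral_cong)
      (auto simp: Suc.IH[of ?T, simplified] All_less_Suc2 split: split_indicator)
  also have "\<dots> = ?p * emeasure ?M (if 0 \<in> S then {c} else UNIV)"
    by (simp add: nn_integral_cmult_indicator)
  also have "emeasure ?M (if 0 \<in> S then {c} else UNIV) = ennreal ((1/2) ^ of_bool (0 \<in> S))"
    using measure_pmf.emeasure_space_1[of "bernoulli_pmf (1/2)"]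
    by (cases c) (simp_all add: emeasure_pmf_single)
  also have "?p * ennreal ((1/2) ^ of_bool (0 \<in> S)) = ennreal ((1/2) ^ (card (?T \<inter> {..<N}) + of_bool (0 \<in> S)))"
    by (subst ennreal_mult[symmetric]) (simp_all add: power_add)
  also have "card (?T \<inter> {..<N}) + of_bool (0 \<in> S) = card (S \<inter> {..<Suc N})"
  proof -
    have split: "S \<inter> {..<Suc N} = Suc ` (?T \<inter> {..<N}) \<union> (S \<inter> {0})"
      by (auto simp: image_iff less_Suc_eq_0_disj)
    show ?thesis
      unfolding split by (subst card_Un_disjoint) (auto simp: card_image)
  qed
  finally show ?case .
qed

lemma null_constant_letters:
  assumes "infinite S"
  shows "{x. \<forall>i\<in>S. x !! i = c} \<in> null_sets uniform_word_measure"
proof -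
  let ?X = "{x. \<forall>i\<in>S. x !! i = c}"
  have sets: "?X \<in> sets uniform_word_measure"
  proof -
    have "{x \<in> space uniform_word_measure. \<forall>i\<in>S. x !! i = c} \<in> sets uniform_word_measure"
      by measurable
    then show ?thesis by simp
  qed
  have bound: "emeasure uniform_word_measure ?X \<le> ennreal ((1/2) ^ n)" for n
  proof -
    obtain T where T: "T \<subseteq> S" "finite T" "card T = n"
      using infinite_arbitrarily_large[OF assms] by blast
    obtain N where N: "T \<subseteq> {..<N}"
      using \<open>finite T\<close> by (metis bounded_nat_set_is_finite finite_nat_iff_bounded)
    have meas: "{x. \<forall>i<N. i \<in> S \<longrightarrow> x !! i = c} \<in> sets uniform_word_measure"
    proof -
      have "{x \<in> space uniform_word_measure. \<forall>i<N. i \<in> S \<longrightarrow> x !! i = c} \<in> sets uniform_word_measure"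
        by measurable
      then show ?thesis by simp
    qed
    have "emeasure uniform_word_measure ?X \<le> emeasure uniform_word_measure {x. \<forall>i<N. i \<in> S \<longrightarrow> x !! i = c}"
      by (intro emeasure_mono meas) auto
    also have "\<dots> = ennreal ((1/2) ^ card (S \<inter> {..<N}))" by (rule emeasure_prescribed_letters)
    also have "\<dots> \<le> ennreal ((1/2) ^ n)"
    proof -
      have "n \<le> card (S \<inter> {..<N})"
        unfolding T(3)[symmetric] using T N by (intro card_mono) auto
      then show ?thesis by (intro ennreal_leI power_decreasing) auto
    qed
    finally show ?thesis .
  qed
  have "(\<lambda>n. ennreal ((1/2) ^ n)) \<longlonglongrightarrow> ennreal 0"
    by (intro tendsto_ennrealI LIMSEQ_power_zero) simp
  then have "emeasure uniform_word_measure ?X \<le> ennreal 0"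
    by (rule LIMSEQ_le_const) (use bound in blast)
  with sets show ?thesis by (simp add: null_sets_def)
qed

lemma null_not_generic: "{x. \<not> generic x} \<in> null_sets uniform_word_measure"
proof -
  have inf: "infinite {i::nat. N \<le> i \<and> even i = p}" for N p
  proof -
    have "\<exists>n\<ge>m. N \<le> n \<and> even n = p" for m
      by (rule exI[of _ "2 * (m + N) + (if p then 0 else 1)"]) auto
    then show ?thesis by (auto simp: infinite_nat_iff_unbounded_le)
  qed
  have "{x. \<not> generic x} = (\<Union>p. \<Union>N. {x. \<forall>i\<in>{i. N \<le> i \<and> even i = p}. x !! i = False})"
    by (auto simp: generic_def)
  moreover have "\<dots> \<in> null_sets uniform_word_measure"
    by (intro null_sets_UN null_constant_letters inf)
  ultimately show ?thesis by simp
qed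

lemma infinite_other_index:
  assumes "infinite S"
  shows "infinite (other_index ` S)"
  unfolding infinite_nat_iff_unbounded_le
proof
  fix m
  obtain l where "l \<in> S" "Suc m \<le> l"
    using assms unfolding infinite_nat_iff_unbounded_le by blast
  then show "\<exists>n\<ge>m. n \<in> other_index ` S"
    by (intro exI[of _ "other_index l"]) (auto simp: other_index_def)
qed

text \<open>
  A generic word whose graph is isomorphic to that of \<open>\<xi>\<close> has the letter 1 at all indices of one of countably many infinite sets that
  depend on \<open>\<xi>\<close> only.
\<close>

lemma null_adjacency_iso:
  assumes \<xi>: "generic \<xi>"
  shows "\<exists>N \<in> null_sets uniform_word_measure. {\<eta>. generic \<eta> \<and> (\<exists>\<phi>. adjacency_iso \<phi> \<xi> \<eta>)} \<subseteq> N"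
proof
  define S where "S i = range (\<lambda>n. lead ((parent ^^ (i + n)) \<xi>))" for i
  let ?N = "\<Union>i. {\<eta>. \<forall>k\<in>S i. \<eta> !! k = True} \<union> {\<eta>. \<forall>k\<in>other_index ` S i. \<eta> !! k = True}"
  have S: "infinite (S i)" for i
  proof -
    have "strict_mono (\<lambda>n. lead ((parent ^^ (i + n)) \<xi>))"
      using strict_mono_lead_ancestor[OF \<xi>] by (auto simp: strict_mono_def)
    then show ?thesis
      unfolding S_def using strict_mono_imp_inj_on finite_imageD infinite_UNIV_nat by blast
  qed
  show "?N \<in> null_sets uniform_word_measure"
    by (intro null_sets_UN null_sets.Un null_constant_letters infinite_other_index S)
  show "{\<eta>. generic \<eta> \<and> (\<exists>\<phi>. adjacency_iso \<phi> \<xi> \<eta>)} \<subseteq> ?N"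
  proof
    fix \<eta> assume "\<eta> \<in> {\<eta>. generic \<eta> \<and> (\<exists>\<phi>. adjacency_iso \<phi> \<xi> \<eta>)}"
    then obtain i where "(\<forall>k\<in>S i. \<eta> !! k) \<or> (\<forall>k\<in>other_index ` S i. \<eta> !! k)"
      using isomorphic_common_letters[OF \<xi>] unfolding S_def by blast
    then show "\<eta> \<in> ?N" by auto
  qed
qed

lemma adjacent_iff_edge:
  assumes "x \<in> basilica_orbit \<xi>" "y \<in> basilica_orbit \<xi>"
  shows "adjacent x y \<longleftrightarrow> (\<exists>e\<in>edges (schreier_graph \<xi>). ends (schreier_graph \<xi>) e = Upair x y)"
  using assms by (auto simp: adjacent_def schreier_graph_def)

lemma adjacency_isoI:
  assumes \<phi>: "bij_betw \<phi> (basilica_orbit \<xi>) (basilica_orbit \<eta>)"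
    and \<psi>: "bij_betw \<psi> (edges (schreier_graph \<xi>)) (edges (schreier_graph \<eta>))"
    and ends: "\<And>e. e \<in> edges (schreier_graph \<xi>) \<Longrightarrow>
      ends (schreier_graph \<eta>) (\<psi> e) = map_uprod \<phi> (ends (schreier_graph \<xi>) e)"
  shows "adjacency_iso \<phi> \<xi> \<eta>"
  unfolding adjacency_iso_def
proof (intro conjI ballI \<phi>)
  fix x y assume xy: "x \<in> basilica_orbit \<xi>" "y \<in> basilica_orbit \<xi>"
  have \<phi>xy: "\<phi> x \<in> basilica_orbit \<eta>" "\<phi> y \<in> basilica_orbit \<eta>" using \<phi> xy by (auto dest: bij_betwE)
  have "ends (schreier_graph \<eta>) (\<psi> e) = Upair (\<phi> x) (\<phi> y) \<longleftrightarrow> ends (schreier_graph \<xi>) e = Upair x y"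
    if e: "e \<in> edges (schreier_graph \<xi>)" for e
  proof -
    obtain z s where zs: "e = (z, s)" "z \<in> basilica_orbit \<xi>" using e by (auto simp: schreier_graph_def)
    have "act s z \<in> basilica_orbit \<xi>" using zs act_in_orbit by blast
    then show ?thesis
      using ends[OF e] zs xy bij_betw_imp_inj_on[OF \<phi>]
      by (auto simp: schreier_graph_def inj_on_eq_iff)
  qed
  moreover have "edges (schreier_graph \<eta>) = \<psi> ` edges (schreier_graph \<xi>)"
    using \<psi> by (simp add: bij_betw_def)
  ultimately show "adjacent (\<phi> x) (\<phi> y) \<longleftrightarrow> adjacent x y"
    unfolding adjacent_iff_edge[OF xy] adjacent_iff_edge[OF \<phi>xy] by simp
qed

lemma iso_classE:
  assumes "\<eta> \<in> iso_class \<xi>"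
  obtains \<phi> \<psi> where "bij_betw \<phi> (basilica_orbit \<xi>) (basilica_orbit \<eta>)"
    "bij_betw \<psi> (edges (schreier_graph \<xi>)) (edges (schreier_graph \<eta>))"
    "\<And>e. e \<in> edges (schreier_graph \<xi>) \<Longrightarrow>
      ends (schreier_graph \<eta>) (\<psi> e) = map_uprod \<phi> (ends (schreier_graph \<xi>) e)"
proof -
  have verts: "verts (schreier_graph \<zeta>) = basilica_orbit \<zeta>" for \<zeta>
    by (simp add: schreier_graph_def)
  show ?thesis
    using assms that unfolding iso_class_def multigraph_iso_def verts mem_Collect_eq by blast
qed

lemma iso_class_adjacency_iso:
  assumes "\<eta> \<in> iso_class \<xi>"
  shows "\<exists>\<phi>. adjacency_iso \<phi> \<xi> \<eta>"
  using assms by (rule iso_classE) (blast intro: adjacency_isoI)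

lemma adjacency_iso_comp:
  assumes "adjacency_iso \<phi> \<xi> \<eta>" "adjacency_iso \<psi> \<eta> \<zeta>"
  shows "adjacency_iso (\<psi> \<circ> \<phi>) \<xi> \<zeta>"
  unfolding adjacency_iso_def
proof (intro conjI ballI)
  show "bij_betw (\<psi> \<circ> \<phi>) (basilica_orbit \<xi>) (basilica_orbit \<zeta>)"
    using assms unfolding adjacency_iso_def by (blast intro: bij_betw_trans)
  fix x y assume xy: "x \<in> basilica_orbit \<xi>" "y \<in> basilica_orbit \<xi>"
  then have "\<phi> x \<in> basilica_orbit \<eta>" "\<phi> y \<in> basilica_orbit \<eta>"
    using assms(1) unfolding adjacency_iso_def by (auto dest: bij_betwE)
  then show "adjacent ((\<psi> \<circ> \<phi>) x) ((\<psi> \<circ> \<phi>) y) \<longleftrightarrow> adjacent x y"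
    using assms xy by (simp add: adjacency_iso_def)
qed

text \<open>
  The word \<open>\<xi>\<close> itself may fail to be generic. It is replaced by a generic member \<open>\<zeta>\<close> of its class; if
  there is none, the class is contained in the null set of words that are not generic.
\<close>

lemma iso_class_subset_null: "\<exists>N \<in> null_sets uniform_word_measure. iso_class \<xi> \<subseteq> N"
proof (cases "\<exists>\<zeta>\<in>iso_class \<xi>. generic \<zeta>")
  case False
  then have "iso_class \<xi> \<subseteq> {x. \<not> generic x}" by blast
  then show ?thesis by (rule bexI[OF _ null_not_generic])
next
  case True
  then obtain \<zeta> \<phi> where \<zeta>: "generic \<zeta>" "adjacency_iso \<phi> \<xi> \<zeta>"
    using iso_class_adjacency_iso by blast
  obtain N where N: "N \<in> null_sets uniform_word_measure"
      "{\<eta>. generic \<eta> \<and> (\<exists>\<phi>. adjacency_iso \<phi> \<zeta> \<eta>)} \<subseteq> N"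
    using null_adjacency_iso[OF \<zeta>(1)] by blast
  have "iso_class \<xi> \<subseteq> N \<union> {x. \<not> generic x}"
    using iso_class_adjacency_iso adjacency_iso_comp[OF adjacency_iso_inv[OF \<zeta>(2)]] N(2) by blast
  then show ?thesis by (rule bexI[OF _ null_sets.Un[OF N(1) null_not_generic]])
qed


section \<open>Measurability by compactness\<close>

text \<open>
  An arbitrary system of constraints, each on finitely many coordinates with
  finitely many values, is solvable if every finite subsystem is: the product of the finite
  discrete spaces \<open>A i\<close> is compact by Tychonoff's theorem, and each constraint defines a closed set.
\<close>

lemma compact_choice:
  assumes fin: "\<And>i. finite (A i)" and supp: "\<And>j. finite (S j)"
    and local: "\<And>j F F'. (\<And>i. i \<in> S j \<Longrightarrow> F i = F' i) \<Longrightarrow> C j F \<Longrightarrow> C j F'"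
    and finite_sat: "\<And>js. \<exists>F. (\<forall>i. F i \<in> A i) \<and> (\<forall>j\<in>set js. C j F)"
  shows "\<exists>F. (\<forall>i. F i \<in> A i) \<and> (\<forall>j. C j F)"
proof -
  let ?X = "product_topology (\<lambda>i. discrete_topology (A i)) UNIV"
  let ?C = "\<lambda>j. {F. (\<forall>i. F i \<in> A i) \<and> C j F}"
  have top: "topspace ?X = {F. \<forall>i. F i \<in> A i}"
    by (auto simp: PiE_def Pi_def)
  have "compact_space ?X"
    by (simp add: compact_space_product_topology compact_space_discrete_topology fin)
  moreover have "closedin ?X (?C j)" for j
    unfolding closedin_def
  proof
    show "?C j \<subseteq> topspace ?X" by (auto simp: top)
    show "openin ?X (topspace ?X - ?C j)"
    proof (subst openin_subopen, intro ballI)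
      fix F assume F: "F \<in> topspace ?X - ?C j"
      \<comment> \<open>A violation of \<open>C j\<close> persists as long as the coordinates in \<open>S j\<close> are kept.\<close>
      let ?N = "PiE UNIV (\<lambda>i. if i \<in> S j then {F i} else A i)"
      have "finite {i. (if i \<in> S j then {F i} else A i) \<noteq> A i}"
        by (rule finite_subset[OF _ supp[of j]]) auto
      then have "openin ?X ?N"
        using F by (subst openin_PiE_gen) (auto simp: top)
      moreover have "F \<in> ?N" using F by (auto simp: top)
      moreover have "?N \<subseteq> topspace ?X - ?C j"
      proof
        fix G assume G: "G \<in> ?N"
        then have GA: "G i \<in> A i" for i
          using F by (cases "i \<in> S j") (auto simp: top PiE_def Pi_def split: if_splits)
        have "G i = F i" if "i \<in> S j" for i using G that by (auto simp: PiE_def Pi_def split: if_splits)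
        then have "\<not> C j G" using local[of j G F] F by (auto simp: top)
        with GA show "G \<in> topspace ?X - ?C j" by (auto simp: top)
      qed
      ultimately show "\<exists>T. openin ?X T \<and> F \<in> T \<and> T \<subseteq> topspace ?X - ?C j" by blast
    qed
  qed
  moreover have "\<Inter>\<F> \<noteq> {}" if F: "finite \<F>" "\<F> \<subseteq> range ?C" for \<F>
  proof -
    obtain J where J: "finite J" "\<F> = ?C ` J"
      using finite_subset_image[OF F] by auto
    obtain js where js: "set js = J" using finite_list[OF J(1)] by blast
    obtain F where F: "\<forall>i. F i \<in> A i" "\<forall>j\<in>set js. C j F" using finite_sat[of js] by auto
    then have "F \<in> \<Inter>\<F>" unfolding J(2) js by simp
    then show ?thesis by auto
  qed
  ultimately have "\<Inter>(range ?C) \<noteq> {}"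
    unfolding compact_space_fip by (elim allE[of _ "range ?C"]) auto
  then obtain F where "\<forall>j. F \<in> ?C j" by auto
  then show ?thesis by auto
qed

text \<open>
  The existential quantifier ranges over an uncountable set of functions, hence describes a
  projection, which need not be measurable. Compactness replaces it by a countable
  intersection, over finite subsystems of constraints, of finite unions, over the values of the
  finitely many coordinates involved.
\<close>

lemma pred_compact_choice:
  fixes C :: "'j::countable \<Rightarrow> ('i \<Rightarrow> 'b) \<Rightarrow> 'm \<Rightarrow> bool"
  assumes fin: "\<And>i. finite (A i)" and ne: "\<And>i. A i \<noteq> {}"
    and supp: "\<And>j. finite (S j)"
    and local: "\<And>j F F' x. (\<And>i. i \<in> S j \<Longrightarrow> F i = F' i) \<Longrightarrow> C j F x \<Longrightarrow> C j F' x"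
    and meas: "\<And>j F. Measurable.pred M (C j F)"
  shows "Measurable.pred M (\<lambda>x. \<exists>F. (\<forall>i. F i \<in> A i) \<and> (\<forall>j. C j F x))"
proof -
  define d where "d i = (SOME a. a \<in> A i)" for i
  have d: "d i \<in> A i" for i using ne[of i] by (auto simp: d_def some_in_eq)
  define supp_of where "supp_of js = (\<Union>j\<in>set js. S j)" for js
  define extend where "extend js G i = (if i \<in> supp_of js then G i else d i)" for js G i
  have fin_supp: "finite (supp_of js)" for js using supp by (simp add: supp_of_def)
  have "(\<exists>F. (\<forall>i. F i \<in> A i) \<and> (\<forall>j. C j F x)) \<longleftrightarrow>
     (\<forall>js. \<exists>G \<in> PiE (supp_of js) A. \<forall>j\<in>set js. C j (extend js G) x)" for x
  proof
    assume "\<exists>F. (\<forall>i. F i \<in> A i) \<and> (\<forall>j. C j F x)"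
    then obtain F where F: "\<And>i. F i \<in> A i" "\<And>j. C j F x" by blast
    show "\<forall>js. \<exists>G \<in> PiE (supp_of js) A. \<forall>j\<in>set js. C j (extend js G) x"
    proof
      fix js
      have "C j (extend js (restrict F (supp_of js))) x" if "j \<in> set js" for j
      proof (rule local[OF _ F(2)])
        fix i assume "i \<in> S j"
        then show "F i = extend js (restrict F (supp_of js)) i"
          using that by (auto simp: extend_def supp_of_def)
      qed
      moreover have "restrict F (supp_of js) \<in> PiE (supp_of js) A" using F by auto
      ultimately show "\<exists>G \<in> PiE (supp_of js) A. \<forall>j\<in>set js. C j (extend js G) x" by blast
    qed
  next
    assume R: "\<forall>js. \<exists>G \<in> PiE (supp_of js) A. \<forall>j\<in>set js. C j (extend js G) x"
    show "\<exists>F. (\<forall>i. F i \<in> A i) \<and> (\<forall>j. C j F x)"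
    proof (rule compact_choice[OF fin supp])
      fix js
      obtain G where "G \<in> PiE (supp_of js) A" "\<forall>j\<in>set js. C j (extend js G) x" using R by blast
      moreover from this have "\<forall>i. extend js G i \<in> A i" using d by (auto simp: extend_def)
      ultimately show "\<exists>F. (\<forall>i. F i \<in> A i) \<and> (\<forall>j\<in>set js. C j F x)" by blast
    qed (use local in blast)
  qed
  moreover have "Measurable.pred M (\<lambda>x. \<forall>js. \<exists>G \<in> PiE (supp_of js) A. \<forall>j\<in>set js. C j (extend js G) x)"
    by (intro pred_intros_countable pred_intros_finite meas finite_PiE fin fin_supp) auto
  ultimately show ?thesis by simp
qed


lemma sets_uniform_word_measure:
  "sets uniform_word_measure = sets (stream_space (count_space UNIV))"
  unfolding uniform_word_measure_def by (rule sets_stream_space_cong) simp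

lemma measurable_act:
  "act s \<in> measurable uniform_word_measure uniform_word_measure" (is ?act)
  "act_inv s \<in> measurable uniform_word_measure uniform_word_measure" (is ?act_inv)
proof -
  let ?M = "stream_space (count_space (UNIV :: bool set))"
  let ?other = "\<lambda>s. if s = Gen_a then Gen_b else Gen_a"
  have act: "(\<lambda>x. act s x !! n) \<in> measurable ?M (count_space UNIV)" for n
  proof (induction n arbitrary: s)
    case 0
    have "act s x !! 0 = (if s = Gen_a then shd x else \<not> shd x)" for x by simp
    then show ?case by (cases s) simp_all
  next
    case (Suc n)
    note [measurable] = measurable_compose[OF measurable_stl Suc.IH]
    have "act s x !! Suc n = (if shd x then stl x !! n else act (?other s) (stl x) !! n)" for x
      by (cases s) simp_all
    moreover have "(\<lambda>x. if shd x then stl x !! n else act (?other s) (stl x) !! n) \<in> measurable ?M (count_space UNIV)"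
      by measurable
    ultimately show ?case by presburger
  qed
  have act_inv: "(\<lambda>x. act_inv s x !! n) \<in> measurable ?M (count_space UNIV)" for n
  proof (induction n arbitrary: s)
    case 0
    have "act_inv s x !! 0 = (if s = Gen_a then shd x else \<not> shd x)" for x by simp
    then show ?case by (cases s) simp_all
  next
    case (Suc n)
    note [measurable] = measurable_compose[OF measurable_stl Suc.IH]
    have "act_inv s x !! Suc n = (if shd x = (s = Gen_a) then stl x !! n else act_inv (?other s) (stl x) !! n)" for x
      by (cases s) simp_all
    moreover have "(\<lambda>x. if shd x = (s = Gen_a) then stl x !! n else act_inv (?other s) (stl x) !! n) \<in> measurable ?M (count_space UNIV)"
      by measurable
    ultimately show ?case by presburger
  qed
  have "act s \<in> measurable ?M ?M" "act_inv s \<in> measurable ?M ?M"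
    using measurable_stream_space2 act act_inv by blast+
  then show ?act ?act_inv
    unfolding measurable_cong_sets[OF sets_uniform_word_measure sets_uniform_word_measure] .
qed

lemma measurable_run: "run w \<in> measurable uniform_word_measure uniform_word_measure"
proof (induction w)
  case Nil
  have "run [] = id" by (simp add: fun_eq_iff)
  then show ?case by (metis measurable_ident)
next
  case (Cons l w)
  obtain s b where "l = (s, b)" by (cases l)
  then have "run (l # w) = (\<lambda>x. (if b then act s else act_inv s) (run w x))"
    by (simp add: fun_eq_iff)
  moreover have "(\<lambda>x. (if b then act s else act_inv s) (run w x)) \<in>
      measurable uniform_word_measure uniform_word_measure"
    by (rule measurable_compose[OF Cons.IH]) (simp add: measurable_act)
  ultimately show ?case by metis
qed

lemma pred_run_eq [measurable]:
  "Measurable.pred uniform_word_measure (\<lambda>x. run u x = run w x)"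
proof -
  have eq: "run u x = run w x \<longleftrightarrow> (\<forall>i. run u x !! i = run w x !! i)" for x
    by (auto intro: word_eqI)
  have "(\<lambda>x. x !! i) \<in> measurable uniform_word_measure (count_space UNIV)" for i
    unfolding measurable_cong_sets[OF sets_uniform_word_measure refl] by (rule measurable_snth)
  note [measurable] = measurable_compose[OF measurable_run this]
  show ?thesis unfolding eq by measurable
qed


section \<open>Isomorphism classes are Borel\<close>

instance gen :: finite
proof
  have "(UNIV :: gen set) = {Gen_a, Gen_b}" by (auto intro: gen.exhaust)
  then show "finite (UNIV :: gen set)" by (metis finite.emptyI finite_insert)
qed

text \<open>
  An isomorphism that maps \<open>v\<close> to \<open>\<eta>\<close> is recorded by group words: index \<open>(w, None)\<close> holds a word
  leading from \<open>\<eta>\<close> to the image of the vertex \<open>run w v\<close>, and index \<open>(w, Some s)\<close> holds a word and a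
  generator naming the image of the edge from \<open>run w v\<close> labelled \<open>s\<close>. Isomorphisms do not
  increase distances, so words of the length allowed here suffice; the summand 1 is for edges, which
  may be traversed in the reverse direction in the image.
\<close>

definition short_codes :: "gword \<times> gen option \<Rightarrow> (gword \<times> gen) set" where
  "short_codes i = {u. length u \<le> length (fst i) + 1} \<times> UNIV"

text \<open>
  The conjuncts say that the recorded maps on vertices and on edges are well-defined and injective,
  that both are onto, and that edges keep their ends. In the surjectivity conditions the length of
  \<open>u\<close> is bounded so that the constraint with index \<open>j\<close> involves finitely many coordinates of \<open>F\<close>.
\<close>

definition codes_iso ::
    "word \<Rightarrow> gword \<times> gword \<times> gen \<times> gen \<Rightarrow> (gword \<times> gen option \<Rightarrow> gword \<times> gen) \<Rightarrow> word \<Rightarrow> bool" where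
  "codes_iso v j F \<eta> \<longleftrightarrow> (case j of (w, w', s, s') \<Rightarrow>
     let f = (\<lambda>u. fst (F (u, None))); g = (\<lambda>u t. fst (F (u, Some t))); h = (\<lambda>u t. snd (F (u, Some t))) in
     (run (f w) \<eta> = run (f w') \<eta> \<longleftrightarrow> run w v = run w' v) \<and>
     (run (g w s) \<eta> = run (g w' s') \<eta> \<and> h w s = h w' s' \<longleftrightarrow> run w v = run w' v \<and> s = s') \<and>
     (\<exists>u. length u \<le> length w + 1 \<and> run (f u) \<eta> = run w \<eta>) \<and>
     (\<exists>u t. length u \<le> length w + 1 \<and> run (g u t) \<eta> = run w \<eta> \<and> h u t = s) \<and>
     (run (g w s) \<eta> = run (f w) \<eta> \<and> run ((h w s, True) # g w s) \<eta> = run (f ((s, True) # w)) \<eta> \<or>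
      run (g w s) \<eta> = run (f ((s, True) # w)) \<eta> \<and> run ((h w s, True) # g w s) \<eta> = run (f w) \<eta>))"

lemma finite_short_words: "finite {u :: gword. length u \<le> n}"
  using finite_lists_length_le[of "UNIV :: (gen \<times> bool) set" n] by simp

lemma pred_codes_iso: "Measurable.pred uniform_word_measure (codes_iso v j F)"
proof -
  obtain w w' s s' where j: "j = (w, w', s, s')" by (cases j)
  show ?thesis
    unfolding j codes_iso_def Let_def prod.case by measurable
qed

lemma codes_iso_local:
  assumes "\<And>i. i \<in> {u. length u \<le> length (fst j) + length (fst (snd j)) + 1} \<times> UNIV \<Longrightarrow> F i = F' i"
  shows "codes_iso v j F \<eta> \<longleftrightarrow> codes_iso v j F' \<eta>"
proof -
  obtain w w' s s' where j: "j = (w, w', s, s')" by (cases j)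
  have short: "F (u, c) = F' (u, c)" if "length u \<le> length w + length w' + 1" for u c
    using assms[of "(u, c)"] that j by simp
  have "F (u, c) = F' (u, c)" if "length u \<le> length w + 1" for u c
    using short that by simp
  then have bounded: "(\<exists>u. length u \<le> length w + 1 \<and> P (F (u, None))) \<longleftrightarrow> (\<exists>u. length u \<le> length w + 1 \<and> P (F' (u, None)))"
    "(\<exists>u t. length u \<le> length w + 1 \<and> Q t (F (u, Some t))) \<longleftrightarrow> (\<exists>u t. length u \<le> length w + 1 \<and> Q t (F' (u, Some t)))"
    for P Q by metis+
  have eq: "F (w, c) = F' (w, c)" "F (w', c) = F' (w', c)" "F ((s, True) # w, c) = F' ((s, True) # w, c)" for c
    by (simp_all add: short)
  show ?thesis
    unfolding j codes_iso_def Let_def prod.case eq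
      bounded(1)[of "\<lambda>c. run (fst c) \<eta> = run w \<eta>"]
      bounded(2)[of "\<lambda>t c. run (fst c) \<eta> = run w \<eta> \<and> snd c = s"] ..
qed

text \<open>
  The image of a walk of length \<open>n\<close> is a walk of length \<open>n\<close>, although with other labels.
\<close>

lemma adjacency_iso_bounded:
  assumes \<phi>: "adjacency_iso \<phi> \<xi> \<eta>" and v: "v \<in> basilica_orbit \<xi>"
  shows "\<exists>u. length u \<le> length w \<and> \<phi> (run w v) = run u (\<phi> v)"
proof (induction w)
  case Nil
  show ?case by (rule exI[of _ "[]"]) simp
next
  case (Cons l w)
  then obtain u where u: "length u \<le> length w" "\<phi> (run w v) = run u (\<phi> v)" by blast
  obtain s b where l: "l = (s, b)" by (cases l)
  have "adjacent (run w v) (run (l # w) v)" using adjacent_act by (simp add: l)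
  then have "adjacent (\<phi> (run w v)) (\<phi> (run (l # w) v))"
    using \<phi> run_in_orbit[OF v] unfolding adjacency_iso_def by blast
  then obtain t where "\<phi> (run (l # w) v) = act t (\<phi> (run w v)) \<or> \<phi> (run w v) = act t (\<phi> (run (l # w) v))"
    unfolding adjacent_def by blast
  then have "\<phi> (run (l # w) v) = run ((t, True) # u) (\<phi> v) \<or> \<phi> (run (l # w) v) = run ((t, False) # u) (\<phi> v)"
    unfolding run_Cons[of "(t, _)"] u(2)[symmetric] by (auto simp: act_inv_act)
  then show ?case using u(1) by (metis Suc_le_mono length_Cons)
qed

lemma factor_through:
  assumes "\<And>p q. G p = G q \<Longrightarrow> K p = K q"
  obtains \<phi> where "\<And>p. \<phi> (G p) = K p"
proof -
  have "K (SOME q. G q = G p) = K p" for p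
    by (rule assms, rule someI[of _ p]) simp
  then show ?thesis by (rule that[of "\<lambda>x. K (SOME q. G q = x)"])
qed

lemma isomorphic_if_codes:
  assumes F: "\<And>j. codes_iso v j F \<eta>"
  shows "\<eta> \<in> iso_class v"
proof -
  define f where "f u = fst (F (u, None))" for u
  define g where "g u t = fst (F (u, Some t))" for u t
  define h where "h u t = snd (F (u, Some t))" for u t
  note F' = F[unfolded codes_iso_def Let_def, of "(w, w', s, s')" for w w' s s', unfolded prod.case, folded f_def g_def h_def]
  have vert: "run (f w) \<eta> = run (f w') \<eta> \<longleftrightarrow> run w v = run w' v" for w w' using F' by blast
  have edge: "run (g w s) \<eta> = run (g w' s') \<eta> \<and> h w s = h w' s' \<longleftrightarrow> run w v = run w' v \<and> s = s'" for w w' s s'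
    using F' by blast
  have vert_onto: "\<exists>u. run (f u) \<eta> = run w \<eta>" for w using F' by blast
  have edge_onto: "\<exists>u t. run (g u t) \<eta> = run w \<eta> \<and> h u t = s" for w s using F' by blast
  have ends: "Upair (run (g w s) \<eta>) (act (h w s) (run (g w s) \<eta>)) = Upair (run (f w) \<eta>) (run (f ((s, True) # w)) \<eta>)" for w s
    using F'[of w w s s] by auto
  obtain \<phi> where \<phi>: "\<And>w. \<phi> (run w v) = run (f w) \<eta>"
    using factor_through[of "\<lambda>w. run w v" "\<lambda>w. run (f w) \<eta>"] vert by blast
  obtain \<psi> where "\<And>p. \<psi> (run (fst p) v, snd p) = (run (g (fst p) (snd p)) \<eta>, h (fst p) (snd p))"
    using factor_through[of "\<lambda>p. (run (fst p) v, snd p)" "\<lambda>p. (run (g (fst p) (snd p)) \<eta>, h (fst p) (snd p))"]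
      edge unfolding prod.inject by blast
  from this[of "(w, s)" for w s] have \<psi>: "\<psi> (run w v, s) = (run (g w s) \<eta>, h w s)" for w s by simp
  have "bij_betw \<phi> (basilica_orbit v) (basilica_orbit \<eta>)"
    unfolding bij_betw_def basilica_orbit_eq
  proof
    show "inj_on \<phi> (range (\<lambda>w. run w v))" by (auto simp: inj_on_def \<phi> vert)
    show "\<phi> ` range (\<lambda>w. run w v) = range (\<lambda>w. run w \<eta>)"
    proof (intro equalityI subsetI)
      fix x assume "x \<in> range (\<lambda>w. run w \<eta>)"
      then obtain w where "x = run w \<eta>" by blast
      moreover obtain u where "run (f u) \<eta> = run w \<eta>" using vert_onto by blast
      ultimately have "x = \<phi> (run u v)" by (simp add: \<phi>)
      then show "x \<in> \<phi> ` range (\<lambda>w. run w v)" by blast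
    qed (auto simp: \<phi>)
  qed
  moreover have "bij_betw \<psi> (basilica_orbit v \<times> UNIV) (basilica_orbit \<eta> \<times> UNIV)"
    unfolding bij_betw_def basilica_orbit_eq
  proof
    show "inj_on \<psi> (range (\<lambda>w. run w v) \<times> UNIV)" using edge by (auto simp: inj_on_def \<psi>)
    show "\<psi> ` (range (\<lambda>w. run w v) \<times> UNIV) = range (\<lambda>w. run w \<eta>) \<times> UNIV"
    proof (intro equalityI subsetI)
      fix e assume "e \<in> range (\<lambda>w. run w \<eta>) \<times> (UNIV :: gen set)"
      then obtain w s where e: "e = (run w \<eta>, s)" by auto
      obtain u t where "run (g u t) \<eta> = run w \<eta>" "h u t = s" using edge_onto by blast
      then have "e = \<psi> (run u v, t)" by (simp add: e \<psi>)
      then show "e \<in> \<psi> ` (range (\<lambda>w. run w v) \<times> UNIV)" by blast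
    qed (auto simp: \<psi>)
  qed
  moreover have "Upair (fst (\<psi> e)) (act (snd (\<psi> e)) (fst (\<psi> e))) = Upair (\<phi> (fst e)) (\<phi> (act (snd e) (fst e)))"
    if edge_e: "e \<in> basilica_orbit v \<times> UNIV" for e
  proof -
    obtain w where "fst e = run w v"
      using edge_e unfolding mem_Times_iff basilica_orbit_eq by blast
    then obtain s where e: "e = (run w v, s)" by (cases e) simp
    have "\<phi> (act s (run w v)) = run (f ((s, True) # w)) \<eta>" using \<phi>[of "(s, True) # w"] by simp
    then show ?thesis using ends[of w s] by (simp add: e \<phi> \<psi>)
  qed
  ultimately show ?thesis
    unfolding iso_class_def multigraph_iso_def mem_Collect_eq
    by (intro exI[of _ \<phi>] exI[of _ \<psi>]) (simp add: schreier_graph_def split_beta)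
qed

lemma codes_if_isomorphic:
  assumes \<phi>: "bij_betw \<phi> (basilica_orbit v) (basilica_orbit \<eta>)"
    and \<psi>: "bij_betw \<psi> (edges (schreier_graph v)) (edges (schreier_graph \<eta>))"
    and ends: "\<And>e. e \<in> edges (schreier_graph v) \<Longrightarrow>
      ends (schreier_graph \<eta>) (\<psi> e) = map_uprod \<phi> (ends (schreier_graph v) e)"
    and root: "\<phi> v = \<eta>"
  shows "\<exists>F. (\<forall>i. F i \<in> short_codes i) \<and> (\<forall>j. codes_iso v j F \<eta>)"
proof -
  have map: "adjacency_iso \<phi> v \<eta>" by (rule adjacency_isoI[OF \<phi> \<psi> ends])
  have in_orbit: "run w x \<in> basilica_orbit x" for w x by (rule run_in_orbit[OF orbit_refl])
  have fwd: "\<exists>u. length u \<le> length w \<and> \<phi> (run w v) = run u \<eta>" for w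
    using adjacency_iso_bounded[OF map orbit_refl] root by simp
  have bwd: "\<exists>u. length u \<le> length w \<and> \<phi> (run u v) = run w \<eta>" for w
  proof -
    let ?\<chi> = "inv_into (basilica_orbit v) \<phi>"
    have "?\<chi> \<eta> = v" using root bij_betw_inv_into_left[OF \<phi> orbit_refl] by simp
    then obtain u where u: "length u \<le> length w" "?\<chi> (run w \<eta>) = run u v"
      using adjacency_iso_bounded[OF adjacency_iso_inv[OF map] orbit_refl, of w] by auto
    have "\<phi> (run u v) = run w \<eta>"
      unfolding u(2)[symmetric] by (rule bij_betw_inv_into_right[OF \<phi> in_orbit])
    with u(1) show ?thesis by blast
  qed
  have edges: "edges (schreier_graph x) = basilica_orbit x \<times> UNIV" for x by (simp add: schreier_graph_def)
  have ends': "Upair (fst (\<psi> (x, s))) (act (snd (\<psi> (x, s))) (fst (\<psi> (x, s)))) = Upair (\<phi> x) (\<phi> (act s x))"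
    if "x \<in> basilica_orbit v" for x s
    using ends[of "(x, s)"] that by (simp add: schreier_graph_def split_beta)
  define spec where "spec i c \<longleftrightarrow> (case i of (w, None) \<Rightarrow> run (fst c) \<eta> = \<phi> (run w v)
      | (w, Some s) \<Rightarrow> \<psi> (run w v, s) = (run (fst c) \<eta>, snd c))" for i c
  have "\<exists>c. c \<in> short_codes i \<and> spec i c" for i
  proof -
    obtain w o' where i: "i = (w, o')" by (cases i)
    show ?thesis
    proof (cases o')
      case None
      obtain u where "length u \<le> length w" "\<phi> (run w v) = run u \<eta>" using fwd by blast
      then show ?thesis
        by (intro exI[of _ "(u, Gen_a)"]) (simp add: i None short_codes_def spec_def)
    next
      case (Some s)
      have "fst (\<psi> (run w v, s)) \<in> {\<phi> (run w v), \<phi> (run ((s, True) # w) v)}"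
        using ends'[OF in_orbit[of w v], of s] by auto
      moreover obtain u u' where "length u \<le> length w" "\<phi> (run w v) = run u \<eta>"
        "length u' \<le> length w + 1" "\<phi> (run ((s, True) # w) v) = run u' \<eta>"
        using fwd[of w] fwd[of "(s, True) # w"] by auto
      ultimately obtain u where "length u \<le> length w + 1" "fst (\<psi> (run w v, s)) = run u \<eta>"
        by (metis insertE le_SucI Suc_eq_plus1 singletonD)
      then show ?thesis
        by (intro exI[of _ "(u, snd (\<psi> (run w v, s)))"]) (simp add: i Some short_codes_def spec_def prod_eq_iff)
    qed
  qed
  then obtain F where F: "\<And>i. F i \<in> short_codes i" "\<And>i. spec i (F i)"
    by metis
  define f where "f u = fst (F (u, None))" for u
  define g where "g u t = fst (F (u, Some t))" for u t
  define h where "h u t = snd (F (u, Some t))" for u t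
  have f: "run (f w) \<eta> = \<phi> (run w v)" for w using F(2)[of "(w, None)"] by (simp add: f_def spec_def)
  have gh: "\<psi> (run w v, s) = (run (g w s) \<eta>, h w s)" for w s using F(2)[of "(w, Some s)"] by (simp add: g_def h_def spec_def)
  have "codes_iso v (w, w', s, s') F \<eta>" for w w' s s'
  proof -
    have c1: "run (f w) \<eta> = run (f w') \<eta> \<longleftrightarrow> run w v = run w' v"
      unfolding f using inj_on_eq_iff[OF bij_betw_imp_inj_on[OF \<phi>] in_orbit in_orbit] .
    have c2: "run (g w s) \<eta> = run (g w' s') \<eta> \<and> h w s = h w' s' \<longleftrightarrow> run w v = run w' v \<and> s = s'"
      using inj_on_eq_iff[OF bij_betw_imp_inj_on[OF \<psi>], of "(run w v, s)" "(run w' v, s')"] in_orbit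
      by (simp add: gh edges)
    have c3: "\<exists>u. length u \<le> length w + 1 \<and> run (f u) \<eta> = run w \<eta>"
      unfolding f using bwd[of w] by (metis le_SucI Suc_eq_plus1)
    have c4: "\<exists>u t. length u \<le> length w + 1 \<and> run (g u t) \<eta> = run w \<eta> \<and> h u t = s"
    proof -
      have "(run w \<eta>, s) \<in> \<psi> ` (basilica_orbit v \<times> UNIV)"
        using bij_betw_imp_surj_on[OF \<psi>] in_orbit by (simp add: edges)
      then obtain x t where xt: "x \<in> basilica_orbit v" "\<psi> (x, t) = (run w \<eta>, s)" by auto
      have "\<phi> x = run w \<eta> \<or> \<phi> x = run ((s, True) # w) \<eta>"
        using ends'[OF xt(1), of t] by (auto simp: xt(2))
      moreover obtain u u' where "length u \<le> length w" "\<phi> (run u v) = run w \<eta>"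
        "length u' \<le> length w + 1" "\<phi> (run u' v) = run ((s, True) # w) \<eta>"
        using bwd[of w] bwd[of "(s, True) # w"] by auto
      ultimately obtain u where u: "length u \<le> length w + 1" "\<phi> (run u v) = \<phi> x"
        by (metis le_SucI Suc_eq_plus1)
      then have "run u v = x"
        using inj_on_eq_iff[OF bij_betw_imp_inj_on[OF \<phi>] in_orbit xt(1)] by simp
      then have "run (g u t) \<eta> = run w \<eta> \<and> h u t = s" using gh[of u t] xt(2) by simp
      then show ?thesis using u(1) by blast
    qed
    have c5: "run (g w s) \<eta> = run (f w) \<eta> \<and> run ((h w s, True) # g w s) \<eta> = run (f ((s, True) # w)) \<eta> \<or>
      run (g w s) \<eta> = run (f ((s, True) # w)) \<eta> \<and> run ((h w s, True) # g w s) \<eta> = run (f w) \<eta>"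
      using ends'[OF in_orbit[of w v], of s] by (simp add: gh f)
    show ?thesis
      unfolding codes_iso_def Let_def prod.case f_def[symmetric] g_def[symmetric] h_def[symmetric]
      by (intro conjI c1 c2 c3 c4 c5)
  qed
  with F(1) show ?thesis by auto
qed

text \<open>
  The class is the union, over the countably many vertices \<open>v\<close> of the graph of \<open>\<xi>\<close>, of the sets of
  those \<open>\<eta>\<close> for which some isomorphism sends \<open>v\<close> to \<open>\<eta>\<close>.
\<close>

lemma iso_class_sets: "iso_class \<xi> \<in> sets uniform_word_measure"
proof -
  let ?R = "\<lambda>v. {\<eta>. \<exists>F. (\<forall>i. F i \<in> short_codes i) \<and> (\<forall>j. codes_iso v j F \<eta>)}"
  have iso_class_eq: "iso_class v = iso_class \<xi>" if "v \<in> basilica_orbit \<xi>" for v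
    unfolding iso_class_def schreier_graph_def orbit_eq[OF that] ..
  have "?R v \<in> sets uniform_word_measure" for v
  proof -
    let ?S = "\<lambda>j :: gword \<times> gword \<times> gen \<times> gen.
      {u :: gword. length u \<le> length (fst j) + length (fst (snd j)) + 1} \<times> (UNIV :: gen option set)"
    have "Measurable.pred uniform_word_measure (\<lambda>\<eta>. \<exists>F. (\<forall>i. F i \<in> short_codes i) \<and> (\<forall>j. codes_iso v j F \<eta>))"
    proof (rule pred_compact_choice[where S = ?S])
      show "finite (short_codes i)" "short_codes i \<noteq> {}" for i
        using finite_short_words by (auto simp: short_codes_def intro: exI[of _ "[]"])
      show "finite (?S j)" for j
        by (intro finite_cartesian_product finite_short_words) simp
      show "codes_iso v j F' \<eta>" if "\<And>i. i \<in> ?S j \<Longrightarrow> F i = F' i" "codes_iso v j F \<eta>" for j F F' \<eta>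
        using that codes_iso_local[of j F F' v \<eta>] by blast
    qed (rule pred_codes_iso)
    then show ?thesis by (simp add: pred_def)
  qed
  moreover have "iso_class \<xi> = (\<Union>w. ?R (run w \<xi>))"
  proof (intro equalityI subsetI)
    fix \<eta> assume "\<eta> \<in> iso_class \<xi>"
    then obtain \<phi> \<psi> where iso: "bij_betw \<phi> (basilica_orbit \<xi>) (basilica_orbit \<eta>)"
      "bij_betw \<psi> (edges (schreier_graph \<xi>)) (edges (schreier_graph \<eta>))"
      "\<And>e. e \<in> edges (schreier_graph \<xi>) \<Longrightarrow>
        ends (schreier_graph \<eta>) (\<psi> e) = map_uprod \<phi> (ends (schreier_graph \<xi>) e)"
      by (rule iso_classE) blast
    obtain v where v: "v \<in> basilica_orbit \<xi>" "\<phi> v = \<eta>"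
      using bij_betw_imp_surj_on[OF iso(1)] orbit_refl[of \<eta>] by (metis imageE)
    then obtain w where w: "v = run w \<xi>" by (auto simp: basilica_orbit_eq)
    have "schreier_graph \<xi> = schreier_graph v"
      unfolding schreier_graph_def orbit_eq[OF v(1)] ..
    then have "\<eta> \<in> ?R v"
      using codes_if_isomorphic[of \<phi> v \<eta> \<psi>] iso v(2) orbit_eq[OF v(1)] by simp
    then show "\<eta> \<in> (\<Union>w. ?R (run w \<xi>))" unfolding w by blast
  next
    fix \<eta> assume "\<eta> \<in> (\<Union>w. ?R (run w \<xi>))"
    then obtain w F where "\<forall>j. codes_iso (run w \<xi>) j F \<eta>" by blast
    then have "\<eta> \<in> iso_class (run w \<xi>)" using isomorphic_if_codes by blast
    then show "\<eta> \<in> iso_class \<xi>" using iso_class_eq run_in_orbit[OF orbit_refl] by blast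
  qed
  ultimately show ?thesis by auto
qed

theorem proposition5p12:
  fixes \<xi> :: word
  shows "iso_class \<xi> \<in> sets uniform_word_measure \<and> emeasure uniform_word_measure (iso_class \<xi>) = 0"
proof
  show sets: "iso_class \<xi> \<in> sets uniform_word_measure" by (rule iso_class_sets)
  from iso_class_subset_null[of \<xi>] obtain N where
    N: "N \<in> null_sets uniform_word_measure" "iso_class \<xi> \<subseteq> N" ..
  from null_sets_subset[OF N(1) sets N(2)] show "emeasure uniform_word_measure (iso_class \<xi>) = 0"
    by (rule null_setsD1)
qed

end
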